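(* Let $M$ be the structure described in the context. Then the theory $T=\mathrm{Th}(M)$ is stable.
   Context: Let $S=\{u\subseteq\omega\mid |u|<\omega\}$ and $V=\{f:S\to\{0,1\}\mid |\mathrm{supp}(f)|<\infty\}$, where $\mathrm{supp}(f)=\{x\in S\mid f(x)\ne 0\}$; $V$ is a group as a vector space over $\mathbb{F}_2=\mathbb{Z}/2\mathbb{Z}$. For $n,m<\omega$ define $G_n=\{f\in V\mid u\in\mathrm{supp}(f)\Rightarrow |u|=n\}$, $G_\omega=\prod_{n<\omega}G_n$ (full direct product), $G_{n,m}=\{f\in V\mid u\in\mathrm{supp}(f)\Rightarrow |u|=n \text{ and } m\in u\}$ (so $G_{0,m}=0$), $H_{n,m}=\{\eta\in G_\omega\mid \eta(n)\in G_{n,m}\}$. The language is $L=\{P,Q\}\cup\{R_n\mid n<\omega\}\cup\{0,+\}$ with $P,Q$ unary predicates and each $R_n$ a binary relation. $M$ is the $L$-structure whose universe is the disjoint union of $P^M=G_\omega$ and $Q^M=\omega$, with $0,+$ interpreted on $P^M$ as the group structure of $G_\omega$ (and, say, $x+y=0$ if $x,y$ are not both in $P^M$), and $R_n^M=\{(\eta,m)\mid \eta\in H_{n,m}\}$. *)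

theory Defs
  imports "HOL-Library.Z2" "HOL-Library.FSet" "HOL-Library.Function_Algebras"
begin

section \<open>The language, its structures and satisfaction\<close>

datatype ltrm = Var nat | Zero | Plus ltrm ltrm

datatype lfm =
    Eq ltrm ltrm
  | PredP ltrm
  | PredQ ltrm
  | RelR nat ltrm ltrm
  | Neg lfm
  | Conj lfm lfm
  | Ex nat lfm

fun tvars :: "ltrm \<Rightarrow> nat set" where
  "tvars (Var k) = {k}"
| "tvars Zero = {}"
| "tvars (Plus s t) = tvars s \<union> tvars t"

fun fvars :: "lfm \<Rightarrow> nat set" where
  "fvars (Eq s t) = tvars s \<union> tvars t"
| "fvars (PredP t) = tvars t"
| "fvars (PredQ t) = tvars t"
| "fvars (RelR n s t) = tvars s \<union> tvars t"
| "fvars (Neg \<phi>) = fvars \<phi>"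
| "fvars (Conj \<phi> \<psi>) = fvars \<phi> \<union> fvars \<psi>"
| "fvars (Ex k \<phi>) = fvars \<phi> - {k}"

record 'a lstruct =
  univ :: "'a set"
  intP :: "'a set"
  intQ :: "'a set"
  intR :: "nat \<Rightarrow> ('a \<times> 'a) set"
  int0 :: 'a
  intplus :: "'a \<Rightarrow> 'a \<Rightarrow> 'a"

definition is_lstruct :: "'a lstruct \<Rightarrow> bool" where
  "is_lstruct N \<longleftrightarrow>
     univ N \<noteq> {} \<and> intP N \<subseteq> univ N \<and> intQ N \<subseteq> univ N \<and>
     (\<forall>n. intR N n \<subseteq> univ N \<times> univ N) \<and>
     int0 N \<in> univ N \<and>
     (\<forall>x\<in>univ N. \<forall>y\<in>univ N. intplus N x y \<in> univ N)"

fun tval :: "'a lstruct \<Rightarrow> (nat \<Rightarrow> 'a) \<Rightarrow> ltrm \<Rightarrow> 'a" where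
  "tval N e (Var k) = e k"
| "tval N e Zero = int0 N"
| "tval N e (Plus s t) = intplus N (tval N e s) (tval N e t)"

fun sat :: "'a lstruct \<Rightarrow> (nat \<Rightarrow> 'a) \<Rightarrow> lfm \<Rightarrow> bool" where
  "sat N e (Eq s t) \<longleftrightarrow> tval N e s = tval N e t"
| "sat N e (PredP t) \<longleftrightarrow> tval N e t \<in> intP N"
| "sat N e (PredQ t) \<longleftrightarrow> tval N e t \<in> intQ N"
| "sat N e (RelR n s t) \<longleftrightarrow> (tval N e s, tval N e t) \<in> intR N n"
| "sat N e (Neg \<phi>) \<longleftrightarrow> \<not> sat N e \<phi>"
| "sat N e (Conj \<phi> \<psi>) \<longleftrightarrow> sat N e \<phi> \<and> sat N e \<psi>"
| "sat N e (Ex k \<phi>) \<longleftrightarrow> (\<exists>x\<in>univ N. sat N (e(k := x)) \<phi>)"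

definition true_in :: "'a lstruct \<Rightarrow> lfm \<Rightarrow> bool" where
  "true_in N \<phi> \<longleftrightarrow> (\<forall>e. range e \<subseteq> univ N \<longrightarrow> sat N e \<phi>)"

definition Th :: "'a lstruct \<Rightarrow> lfm set" where
  "Th N = {\<phi>. fvars \<phi> = {} \<and> true_in N \<phi>}"

definition is_model :: "'a lstruct \<Rightarrow> lfm set \<Rightarrow> bool" where
  "is_model N T \<longleftrightarrow> is_lstruct N \<and> (\<forall>\<phi>\<in>T. true_in N \<phi>)"

section \<open>Stability\<close>

text \<open>
  The order property in \<open>N\<close> of \<open>\<phi>(x, y)\<close>, where \<open>x\<close> is the tuple of the first \<open>p\<close> variables
  and \<open>y\<close> the tuple of the next \<open>q\<close> variables. The value of the assignment at indices
  from \<open>p + q\<close> on is irrelevant, since these variables are not free in \<open>\<phi>\<close>.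
\<close>
definition order_property :: "'a lstruct \<Rightarrow> nat \<Rightarrow> nat \<Rightarrow> lfm \<Rightarrow> bool" where
  "order_property N p q \<phi> \<longleftrightarrow>
     fvars \<phi> \<subseteq> {..<p + q} \<and>
     (\<exists>a b :: nat \<Rightarrow> 'a list.
        (\<forall>i. length (a i) = p \<and> set (a i) \<subseteq> univ N) \<and>
        (\<forall>j. length (b j) = q \<and> set (b j) \<subseteq> univ N) \<and>
        (\<forall>i j. sat N (\<lambda>k. (a i @ b j) ! k) \<phi> \<longleftrightarrow> i < j))"

text \<open>
  A theory is stable if no formula has the order property in any of its models. A definition
  in HOL cannot quantify over types, so the type in which the universes of the models live is a
  parameter; stability is this property for an arbitrary type \<open>'a\<close>.
\<close>
definition stable :: "'a itself \<Rightarrow> lfm set \<Rightarrow> bool" where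
  "stable (_ :: 'a itself) T \<longleftrightarrow>
     (\<forall>N :: 'a lstruct. is_model N T \<longrightarrow> (\<forall>\<phi> p q. \<not> order_property N p q \<phi>))"

section \<open>The structure\<close>

text \<open>
  The set of finite subsets of \<open>\<omega>\<close> is the type \<^typ>\<open>nat fset\<close>, and \<open>{0,1}\<close> is the
  two-element field \<^typ>\<open>bit\<close>. Addition and zero on functions are pointwise.
\<close>
definition supp :: "(nat fset \<Rightarrow> bit) \<Rightarrow> nat fset set" where
  "supp f = {u. f u \<noteq> 0}"

definition Vgrp :: "(nat fset \<Rightarrow> bit) set" where
  "Vgrp = {f. finite (supp f)}"

definition Ggrp :: "nat \<Rightarrow> (nat fset \<Rightarrow> bit) set" where
  "Ggrp n = {f \<in> Vgrp. \<forall>u\<in>supp f. fcard u = n}"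

definition Gomega :: "(nat \<Rightarrow> nat fset \<Rightarrow> bit) set" where
  "Gomega = {\<eta>. \<forall>n. \<eta> n \<in> Ggrp n}"

definition Gsub :: "nat \<Rightarrow> nat \<Rightarrow> (nat fset \<Rightarrow> bit) set" where
  "Gsub n m = {f \<in> Vgrp. \<forall>u\<in>supp f. fcard u = n \<and> m |\<in>| u}"

definition Hsub :: "nat \<Rightarrow> nat \<Rightarrow> (nat \<Rightarrow> nat fset \<Rightarrow> bit) set" where
  "Hsub n m = {\<eta> \<in> Gomega. \<eta> n \<in> Gsub n m}"

type_synonym melem = "(nat \<Rightarrow> nat fset \<Rightarrow> bit) + nat"

fun Mplus :: "melem \<Rightarrow> melem \<Rightarrow> melem" where
  "Mplus (Inl \<eta>) (Inl \<theta>) = Inl (\<eta> + \<theta>)"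
| "Mplus _ _ = Inl 0"

definition Mstruct :: "melem lstruct" where
  "Mstruct = \<lparr>
     univ = Gomega <+> UNIV,
     intP = Inl ` Gomega,
     intQ = range Inr,
     intR = (\<lambda>n. {(Inl \<eta>, Inr m) | \<eta> m. \<eta> \<in> Hsub n m}),
     int0 = Inl 0,
     intplus = Mplus\<rparr>"

lemma zero_in_Gomega: "0 \<in> Gomega"
  by (simp add: Gomega_def Ggrp_def Vgrp_def supp_def)

lemma plus_in_Gomega:
  assumes "\<eta> \<in> Gomega" "\<theta> \<in> Gomega"
  shows "\<eta> + \<theta> \<in> Gomega"
proof -
  have sub: "supp ((\<eta> + \<theta>) n) \<subseteq> supp (\<eta> n) \<union> supp (\<theta> n)" for n
    by (auto simp: supp_def)
  have fin: "finite (supp (\<eta> n) \<union> supp (\<theta> n))" for n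
    using assms by (simp add: Gomega_def Ggrp_def Vgrp_def)
  have "\<forall>u \<in> supp (\<eta> n) \<union> supp (\<theta> n). fcard u = n" for n
    using assms by (auto simp: Gomega_def Ggrp_def)
  then show ?thesis
    using sub finite_subset[OF sub fin]
    unfolding Gomega_def Ggrp_def Vgrp_def by blast
qed

lemma is_lstruct_Mstruct: "is_lstruct Mstruct"
  using zero_in_Gomega plus_in_Gomega
  by (auto simp: is_lstruct_def Mstruct_def Hsub_def)

lemma is_model_Th_self: "is_lstruct N \<Longrightarrow> is_model N (Th N)"
  by (simp add: is_model_def Th_def)

end

theory Submission
  imports Defs "HOL-Library.Multiset_Order" "HOL-Library.Ramsey"
begin

text \<open>
  The subgroups \<open>G\<^sub>n\<^sub>,\<^sub>m\<close> of \<open>G\<^sub>n\<close> are spanned by sets of standard basis vectors, so all sums and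
  intersections of them can be described by covers: for a finite family \<open>F\<close> of finite sets, \<open>covers F f\<close> says
  that every set in the support of \<open>f\<close> includes a member of \<open>F\<close>. Thus \<open>R\<^sub>n(\<eta>, m)\<close> says that
  \<open>{{m}}\<close> covers \<open>\<eta>(n)\<close>, and if \<open>F\<close> covers \<open>f\<close> and \<open>G\<close> covers \<open>g\<close>, then \<open>F \<union> G\<close> covers
  \<open>f + g\<close>. The proof has two halves.

  \<^bold>\<open>Truth is decided by small covers.\<close> For a formula \<open>\<phi>\<close> there are \<open>V\<close>, \<open>K\<close> and \<open>k\<close> such that the
  truth of \<open>\<phi>\<close> at an assignment depends only on which of the first \<open>V\<close> variables take which values in
  \<open>\<omega>\<close>, on which sums of their values in \<open>G\<^sub>\<omega>\<close> vanish, and on which families of at most \<open>k\<close> sets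
  cover the coordinates below \<open>K\<close> of these sums (\<open>sat_sim\<close>). This is a back-and-forth argument. An
  element of \<open>\<omega>\<close> is answered by itself. An element \<open>\<zeta>\<close> of \<open>G\<^sub>\<omega>\<close> is answered one coordinate at a time
  (\<open>extend_coordinate\<close>): the families with at most \<open>l\<close> members that cover \<open>\<zeta> + \<sigma>\<close> are controlled by
  a single finite antichain, the \<open>core\<close> of \<open>\<zeta> + \<sigma>\<close>, of size at most \<open>l ^ n\<close>. The cores for the
  various known \<open>\<sigma>\<close> prescribe the answer at some sets and leave it free at others; a Chinese
  remainder argument shows that the prescriptions are compatible, and many new sets are added to the
  support at the free places, so that no unwanted family becomes a cover. The bound \<open>l\<close> has to be large
  compared with the sizes of the cores at level \<open>l\<close> itself; a well-founded descent on multisets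
  provides a level at which the cores have stopped changing (\<open>stationary_level\<close>).

  \<^bold>\<open>A long chain contains a symmetric pair.\<close> If \<open>\<phi>\<close> has the order property in a model of the theory,
  then the structure \<open>M\<close> itself has arbitrarily long finite chains \<open>a\<^sub>i\<close>, \<open>b\<^sub>j\<close> with
  \<open>\<phi>(a\<^sub>i, b\<^sub>j)\<close> exactly for \<open>i < j\<close> (\<open>finite_chains_in_M\<close>). A sum of values of \<open>(a\<^sub>i, b\<^sub>j)\<close> has the
  form \<open>\<alpha>\<^sub>i + \<beta>\<^sub>j\<close>, and for all \<open>h < i < j < l\<close>
  the equation \<open>\<alpha>\<^sub>j + \<beta>\<^sub>i = (\<alpha>\<^sub>j + \<beta>\<^sub>l) + (\<alpha>\<^sub>h + \<beta>\<^sub>l) + (\<alpha>\<^sub>h + \<beta>\<^sub>i)\<close>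
  expresses an entry against the order by three entries along the order. After a Ramsey argument
  the cores of these three entries, for varying \<open>h\<close> and \<open>l\<close>, share what is needed to cover
  \<open>\<alpha>\<^sub>j + \<beta>\<^sub>i\<close>, and the shared part is, up to a permutation that exchanges the roles of \<open>i\<close> and \<open>j\<close>,
  contained in the core of \<open>\<alpha>\<^sub>i + \<beta>\<^sub>j\<close> (\<open>swap_covers\<close>). Permutations of \<open>\<omega>\<close> act on \<open>M\<close> by automorphisms,
  so by the first half \<open>\<phi>(a\<^sub>i, b\<^sub>j)\<close> and \<open>\<phi>(a\<^sub>j, b\<^sub>i)\<close> are equivalent for some \<open>i < j\<close>, a contradiction.
\<close>

section \<open>Covers and cores\<close>

definition covers :: "nat fset set \<Rightarrow> (nat fset \<Rightarrow> bit) \<Rightarrow> bool" where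
  "covers F f \<longleftrightarrow> (\<forall>u. f u \<noteq> 0 \<longrightarrow> (\<exists>s\<in>F. s |\<subseteq>| u))"

definition small :: "nat \<Rightarrow> 'b set \<Rightarrow> bool" where
  "small k F \<longleftrightarrow> finite F \<and> card F \<le> k"

lemma small_mono: "small k F \<Longrightarrow> k \<le> l \<Longrightarrow> small l F"
  by (simp add: small_def)

lemma small_Un: "small k F \<Longrightarrow> small l G \<Longrightarrow> small (k + l) (F \<union> G)"
  unfolding small_def using card_Un_le[of F G] by auto

lemma bit_add_eq_0_iff: "(x :: bit) + y = 0 \<longleftrightarrow> x = y"
  by (cases x; cases y) auto

lemma covers_refine:
  assumes "covers F f" "\<And>s. s \<in> F \<Longrightarrow> \<exists>t\<in>G. t |\<subseteq>| s"
  shows "covers G f"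
  using assms unfolding covers_def by (meson order_trans)

lemma covers_add:
  assumes "covers F f" "covers G g"
  shows "covers (F \<union> G) (f + g)"
  unfolding covers_def
proof (intro allI impI)
  fix u assume "(f + g) u \<noteq> 0"
  then have "f u \<noteq> 0 \<or> g u \<noteq> 0" by (metis add.right_neutral plus_fun_apply)
  then show "\<exists>s\<in>F \<union> G. s |\<subseteq>| u" using assms unfolding covers_def by blast
qed

text \<open>
  A set belongs to the hull if no family of at most \<open>k\<close> sets that covers \<open>f\<close> can avoid covering it
  too. Every set in the support belongs to the hull, but also, for instance, the common intersection
  of more than \<open>k\<close> sets of the support that are otherwise disjoint.
\<close>

definition hull :: "nat \<Rightarrow> (nat fset \<Rightarrow> bit) \<Rightarrow> nat fset set" where
  "hull k f = {t. \<forall>F. small k F \<longrightarrow> covers F f \<longrightarrow> (\<exists>s\<in>F. s |\<subseteq>| t)}"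

text \<open>
  The hull is closed upwards, so the core describes it up to size \<open>n\<close>. For \<open>f\<close> supported on
  \<open>n\<close>-element sets the core is itself a cover of \<open>f\<close> (\<open>covers_core\<close>) and lies below every cover with
  at most \<open>k\<close> members (\<open>core_below_cover\<close>); so a family with at most \<open>k\<close> members covers \<open>f\<close>
  exactly if it has a member below every element of the core.
\<close>

definition core :: "nat \<Rightarrow> nat \<Rightarrow> (nat fset \<Rightarrow> bit) \<Rightarrow> nat fset set" where
  "core n k f = {s \<in> hull k f. fcard s \<le> n \<and> (\<forall>t. t |\<subset>| s \<longrightarrow> t \<notin> hull k f)}"

lemma hull_antimono: "k \<le> l \<Longrightarrow> hull l f \<subseteq> hull k f"
  unfolding hull_def using small_mono by blast

lemma core_subset_hull: "s \<in> core n k f \<Longrightarrow> s \<in> hull k f"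
  by (simp add: core_def)

lemma hull_above_core:
  assumes "t \<in> hull k f" "fcard t \<le> n"
  shows "\<exists>s\<in>core n k f. s |\<subseteq>| t"
  using assms
proof (induction "fcard t" arbitrary: t rule: less_induct)
  case less
  show ?case
  proof (cases "\<exists>r. r |\<subset>| t \<and> r \<in> hull k f")
    case True
    then obtain r where r: "r |\<subset>| t" "r \<in> hull k f" by blast
    then have "fcard r < fcard t" by (simp add: pfsubset_fcard_mono)
    moreover have "fcard r \<le> n" using \<open>fcard r < fcard t\<close> less.prems(2) by linarith
    ultimately obtain s where "s \<in> core n k f" "s |\<subseteq>| r" using less.hyps[of r] r(2) by blast
    then show ?thesis using r by (meson less_imp_le order_trans)
  next
    case False
    then show ?thesis using less.prems unfolding core_def by blast
  qed
qed

lemma covers_core: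
  assumes "f \<in> Ggrp n"
  shows "covers (core n k f) f"
  unfolding covers_def
proof (intro allI impI)
  fix u assume u: "f u \<noteq> 0"
  then have "u \<in> hull k f" unfolding hull_def covers_def by blast
  moreover have "fcard u = n" using assms u by (simp add: Ggrp_def supp_def)
  ultimately show "\<exists>s\<in>core n k f. s |\<subseteq>| u" using hull_above_core by simp
qed

lemma core_below_cover:
  assumes "small k F" "covers F f" "s \<in> core n k f"
  shows "\<exists>t\<in>F. t |\<subseteq>| s"
  using assms unfolding core_def hull_def by blast

lemma core_antichain:
  assumes "s \<in> core n k f" "t \<in> core n k f" "t |\<subseteq>| s"
  shows "t = s"
  using assms unfolding core_def by (metis (lifting) mem_Collect_eq order_le_less)

lemma core_level_mono:
  assumes "k \<le> l" "s \<in> core n l f"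
  shows "\<exists>t\<in>core n k f. t |\<subseteq>| s"
proof -
  have "s \<in> hull k f" "fcard s \<le> n"
    using assms(2) hull_antimono[OF assms(1), of f] unfolding core_def by auto
  then show ?thesis by (rule hull_above_core)
qed

text \<open>
  Branching: if \<open>t\<close> is in the hull, it is the only candidate above itself. Otherwise some cover \<open>F\<close>
  with at most \<open>k\<close> members has no member below \<open>t\<close>, and every core element above \<open>t\<close> lies above
  \<open>t |\<union>| r\<close> for some \<open>r\<close> in \<open>F\<close>, a strictly larger set. The branching stops at size \<open>n\<close>.
\<close>

lemma small_core_above:
  assumes "k \<ge> 1"
  shows "small (k ^ (n - fcard t)) {s \<in> core n k f. t |\<subseteq>| s}"
proof (induction "n - fcard t" arbitrary: t rule: less_induct)
  case less
  show ?case
  proof (cases "t \<in> hull k f")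
    case True
    then have "s = t" if "s \<in> core n k f" "t |\<subseteq>| s" for s
      using that unfolding core_def by (metis (lifting) mem_Collect_eq order_le_less)
    then have "{s \<in> core n k f. t |\<subseteq>| s} \<subseteq> {t}" by blast
    then have "card {s \<in> core n k f. t |\<subseteq>| s} \<le> 1" "finite {s \<in> core n k f. t |\<subseteq>| s}"
      using card_mono[of "{t}" "{s \<in> core n k f. t |\<subseteq>| s}"] finite_subset[of _ "{t}"] by simp_all
    then show ?thesis using assms unfolding small_def
      by (meson le_trans one_le_power)
  next
    case False
    then obtain F where F: "small k F" "covers F f" "\<forall>s\<in>F. \<not> s |\<subseteq>| t"
      unfolding hull_def by blast
    show ?thesis
    proof (cases "fcard t < n")
      case False
      have "s = t" if "s \<in> core n k f" "t |\<subseteq>| s" for s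
      proof -
        have "fcard s \<le> fcard t" using that(1) False by (simp add: core_def)
        then show ?thesis using fcard_seteq[OF that(2)] by simp
      qed
      then have "{s \<in> core n k f. t |\<subseteq>| s} = {}"
        using \<open>t \<notin> hull k f\<close> core_subset_hull by blast
      then show ?thesis unfolding small_def by (metis card.empty finite.emptyI le0)
    next
      case True
      have sub: "{s \<in> core n k f. t |\<subseteq>| s} \<subseteq> (\<Union>r\<in>F. {s \<in> core n k f. t |\<union>| r |\<subseteq>| s})"
      proof
        fix s assume "s \<in> {s \<in> core n k f. t |\<subseteq>| s}"
        then have s: "s \<in> core n k f" "t |\<subseteq>| s" by simp_all
        then obtain r where "r \<in> F" "r |\<subseteq>| s" using core_below_cover[OF F(1,2)] by blast
        then show "s \<in> (\<Union>r\<in>F. {s \<in> core n k f. t |\<union>| r |\<subseteq>| s})" using s by (intro UN_I[of r]) simp_all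
      qed
      have each: "small (k ^ (n - Suc (fcard t))) {s \<in> core n k f. t |\<union>| r |\<subseteq>| s}" if "r \<in> F" for r
      proof -
        have "t |\<subset>| t |\<union>| r" using F(3) that by blast
        then have c: "fcard t < fcard (t |\<union>| r)" by (simp add: pfsubset_fcard_mono)
        then have "small (k ^ (n - fcard (t |\<union>| r))) {s \<in> core n k f. t |\<union>| r |\<subseteq>| s}"
          using c True by (intro less) linarith
        moreover have "k ^ (n - fcard (t |\<union>| r)) \<le> k ^ (n - Suc (fcard t))"
          using c assms by (intro power_increasing) auto
        ultimately show ?thesis by (rule small_mono)
      qed
      have finF: "finite F" "card F \<le> k" using F(1) by (auto simp: small_def)
      have "finite (\<Union>r\<in>F. {s \<in> core n k f. t |\<union>| r |\<subseteq>| s})"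
        using finF each by (auto simp: small_def)
      then have fin: "finite {s \<in> core n k f. t |\<subseteq>| s}" using sub finite_subset by blast
      have "card {s \<in> core n k f. t |\<subseteq>| s} \<le> card (\<Union>r\<in>F. {s \<in> core n k f. t |\<union>| r |\<subseteq>| s})"
        using \<open>finite (\<Union>r\<in>F. _ r)\<close> sub by (rule card_mono)
      also have "\<dots> \<le> (\<Sum>r\<in>F. card {s \<in> core n k f. t |\<union>| r |\<subseteq>| s})"
        using finF by (intro card_UN_le)
      also have "\<dots> \<le> (\<Sum>r\<in>F. k ^ (n - Suc (fcard t)))"
        using each by (intro sum_mono) (auto simp: small_def)
      also have "\<dots> \<le> k * k ^ (n - Suc (fcard t))" using finF by simp
      also have "\<dots> = k ^ (n - fcard t)" using True
        by (metis Suc_diff_Suc power_Suc)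
      finally show ?thesis using fin by (simp add: small_def)
    qed
  qed
qed

lemma small_core: "k \<ge> 1 \<Longrightarrow> small (k ^ n) (core n k f)"
  using small_core_above[of k n "{||}" f] by (simp add: fcard_fempty)

text \<open>
  If the \<open>n\<close>-element set \<open>s\<close> of the core were not in the support, the rest of the core would still be
  a cover of \<open>f\<close>. It is small for the level \<open>l\<close>, so it would have a member below \<open>s\<close>, which the
  antichain property forbids.
\<close>

lemma core_top_in_support:
  assumes "f \<in> Ggrp n" "k \<ge> 1" "k ^ n \<le> l" "core n l f = core n k f"
    and s: "s \<in> core n k f" "fcard s = n"
  shows "f s \<noteq> 0"
proof
  assume f0: "f s = 0"
  let ?F = "core n k f - {s}"
  have "covers ?F f" unfolding covers_def
  proof (intro allI impI)
    fix u assume u: "f u \<noteq> 0"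
    then obtain t where t: "t \<in> core n k f" "t |\<subseteq>| u"
      using covers_core[OF assms(1)] unfolding covers_def by blast
    have "fcard u = n" using assms(1) u by (simp add: Ggrp_def supp_def)
    then have "t \<noteq> s" using t u f0 s(2) fcard_seteq[of s u] by auto
    then show "\<exists>s\<in>?F. s |\<subseteq>| u" using t by blast
  qed
  moreover have "small l ?F"
    using small_core[OF assms(2), of n f] assms(3) unfolding small_def
    by (meson card_Diff1_le finite_Diff le_trans)
  ultimately obtain t where "t \<in> ?F" "t |\<subseteq>| s"
    using core_below_cover[of l ?F f s n] assms(4) s(1) by blast
  then show False using core_antichain[OF s(1)] by blast
qed

section \<open>A level at which the cores are stationary\<close>

text \<open>
  Raising the level drops members of the core or replaces them by strictly larger sets. Counting each \<open>s\<close> with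
  weight \<open>n - fcard s\<close> turns this into a descent in the multiset order.
\<close>

definition weight :: "nat \<Rightarrow> nat fset set \<Rightarrow> nat multiset" where
  "weight n D = image_mset (\<lambda>s. n - fcard s) (mset_set D)"

lemma weight_core_less:
  assumes "1 \<le> k" "k \<le> l" "core n l f \<noteq> core n k f"
  shows "weight n (core n l f) < weight n (core n k f)"
proof -
  let ?D = "core n k f" and ?E = "core n l f"
  have fin: "finite ?D" "finite ?E"
    using small_core[of k n f] small_core[of l n f] assms by (auto simp: small_def)
  have up: "\<exists>t\<in>?D - ?E. t |\<subset>| s" if s: "s \<in> ?E - ?D" for s
  proof -
    obtain t where t: "t \<in> ?D" "t |\<subseteq>| s" using core_level_mono[OF assms(2)] s by blast
    then show ?thesis using s core_antichain[of s n l f t]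
      by (metis Diff_iff order_le_less)
  qed
  have ne: "?D - ?E \<noteq> {}"
  proof
    assume "?D - ?E = {}"
    then show False using up assms(3) by blast
  qed
  have "mset_set ?D = mset_set (?D \<inter> ?E) + mset_set (?D - ?E)"
    "mset_set ?E = mset_set (?D \<inter> ?E) + mset_set (?E - ?D)"
    using fin by (subst mset_set_Union[symmetric]; auto intro: arg_cong[of _ _ mset_set])+
  then have "weight n ?D = weight n (?D \<inter> ?E) + weight n (?D - ?E)"
    "weight n ?E = weight n (?D \<inter> ?E) + weight n (?E - ?D)"
    by (simp_all add: weight_def)
  moreover have "multp (<) (weight n (?D \<inter> ?E) + weight n (?E - ?D)) (weight n (?D \<inter> ?E) + weight n (?D - ?E))"
  proof (rule one_step_implies_multp)
    show "weight n (?D - ?E) \<noteq> {#}" using ne fin by (simp add: weight_def mset_set_empty_iff)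
    show "\<forall>x\<in>#weight n (?E - ?D). \<exists>y\<in>#weight n (?D - ?E). x < y"
    proof
      fix x assume "x \<in># weight n (?E - ?D)"
      then obtain s where s: "s \<in> ?E - ?D" "x = n - fcard s" using fin by (auto simp: weight_def)
      then obtain t where t: "t \<in> ?D - ?E" "t |\<subset>| s" using up by blast
      have "fcard s \<le> n" using s by (simp add: core_def)
      then have "x < n - fcard t" using s pfsubset_fcard_mono[OF t(2)] by simp
      then show "\<exists>y\<in>#weight n (?D - ?E). x < y" using t fin by (auto simp: weight_def)
    qed
  qed
  ultimately show ?thesis by (simp add: less_multiset_def)
qed

text \<open>
  No sequence descends strictly forever, and since the \<open>i\<close>-th entry ranges over a finite set that does not depend
  on the sequence, the tree of all descents is finitely branching; this makes the bound \<open>L\<close> uniform.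
\<close>

lemma stationary_step_bound:
  fixes B :: "nat \<Rightarrow> 'b :: wellorder set"
  assumes fin: "\<And>i. finite (B i)"
  shows "\<exists>L. \<forall>v. (\<forall>i. v i \<in> B i) \<longrightarrow> (\<forall>i. v (Suc i) \<le> v i) \<longrightarrow> (\<exists>i<L. v (Suc i) = v i)"
proof -
  define P where "P L m x \<longleftrightarrow> (\<forall>v. (\<forall>i. v i \<in> B i) \<longrightarrow> (\<forall>i. v (Suc i) \<le> v i) \<longrightarrow> v m = x \<longrightarrow>
      (\<exists>i<L. v (Suc i) = v i))" for L m x
  have start: "\<exists>L. P L m x" for x m
  proof (induction x arbitrary: m rule: less_induct)
    case (less x)
    then have "\<forall>y. \<exists>L. y < x \<longrightarrow> P L (Suc m) y" by blast
    then obtain L where L: "\<And>y. y < x \<Longrightarrow> P (L y) (Suc m) y" by metis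
    let ?L = "Max (insert (Suc m) (L ` B (Suc m)))"
    have "P ?L m x" unfolding P_def
    proof (intro allI impI)
      fix v assume v: "\<forall>i. v i \<in> B i" "\<forall>i. v (Suc i) \<le> v i" "v m = x"
      show "\<exists>i<?L. v (Suc i) = v i"
      proof (cases "v (Suc m) = v m")
        case True
        moreover have "m < ?L" using fin by (simp add: Suc_le_lessD)
        ultimately show ?thesis by blast
      next
        case False
        then have "v (Suc m) < x" using v(2)[rule_format, of m] v(3) by (simp add: order_less_le)
        then obtain i where i: "i < L (v (Suc m))" "v (Suc i) = v i"
          using L[of "v (Suc m)"] v(1,2) unfolding P_def by blast
        moreover have "L (v (Suc m)) \<le> ?L" using v fin by (intro Max_ge) auto
        ultimately show ?thesis by (meson less_le_trans)
      qed
    qed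
    then show ?case by blast
  qed
  have "\<forall>x. \<exists>L. P L 0 x" using start by blast
  then obtain L where L: "\<And>x. P (L x) 0 x" by metis
  have "\<exists>i<Max (insert 0 (L ` B 0)). v (Suc i) = v i"
    if v: "\<forall>i. v i \<in> B i" "\<forall>i. v (Suc i) \<le> v i" for v
  proof -
    obtain i where "i < L (v 0)" "v (Suc i) = v i" using L[of "v 0"] v unfolding P_def by blast
    moreover have "L (v 0) \<le> Max (insert 0 (L ` B 0))" using v fin by (intro Max_ge) auto
    ultimately show ?thesis by (meson less_le_trans)
  qed
  then show ?thesis by blast
qed

text \<open>
  The increments are chosen so that the union of a core at level \<open>level n k i\<close> with a family of at
  most \<open>k\<close> sets is small for the next level.
\<close>

primrec level :: "nat \<Rightarrow> nat \<Rightarrow> nat \<Rightarrow> nat" where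
  "level n k 0 = Suc k"
| "level n k (Suc i) = level n k i + k + level n k i ^ n"

lemma level_ge: "Suc k \<le> level n k i"
  by (induction i) auto

lemma level_mono: "i \<le> j \<Longrightarrow> level n k i \<le> level n k j"
  by (rule lift_Suc_mono_le[of "level n k"]) auto

lemma finite_bounded_multisets: "finite {X :: nat multiset. set_mset X \<subseteq> {..n} \<and> size X \<le> m}"
proof -
  have "{X :: nat multiset. set_mset X \<subseteq> {..n} \<and> size X \<le> m} \<subseteq>
      mset ` {xs. set xs \<subseteq> {..n} \<and> length xs \<le> m}"
  proof
    fix X :: "nat multiset" assume X: "X \<in> {X. set_mset X \<subseteq> {..n} \<and> size X \<le> m}"
    obtain xs where "mset xs = X" using ex_mset by blast
    with X show "X \<in> mset ` {xs. set xs \<subseteq> {..n} \<and> length xs \<le> m}" by force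
  qed
  then show ?thesis by (rule finite_subset) (simp add: finite_lists_length_le)
qed

text \<open>
  The bound \<open>L\<close> is the same for all \<open>f\<close>. This uniformity is what allows the back-and-forth argument
  to fix its parameters before the new element is known.
\<close>

lemma stationary_level:
  assumes I: "finite I"
  shows "\<exists>L. \<forall>f :: 'i \<Rightarrow> nat fset \<Rightarrow> bit.
    (\<exists>i<L. \<forall>A\<in>I. core n (level n k (Suc i)) (f A) = core n (level n k i) (f A))"
proof -
  define B where "B i = {X :: nat multiset. set_mset X \<subseteq> {..n} \<and> size X \<le> card I * level n k i ^ n}" for i
  obtain L where L: "\<And>v. (\<forall>i. v i \<in> B i) \<Longrightarrow> (\<forall>i. v (Suc i) \<le> v i) \<Longrightarrow> \<exists>i<L. v (Suc i) = v i"
    using stationary_step_bound[of B] finite_bounded_multisets unfolding B_def by blast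
  have "\<exists>i<L. \<forall>A\<in>I. core n (level n k (Suc i)) (f A) = core n (level n k i) (f A)"
    for f :: "'i \<Rightarrow> nat fset \<Rightarrow> bit"
  proof -
    define w where "w i A = weight n (core n (level n k i) (f A))" for i A
    define v where "v i = (\<Sum>A\<in>I. w i A)" for i
    have lev1: "1 \<le> level n k i" for i using level_ge[of k n i] by linarith
    have fin: "finite (core n (level n k i) (f A))" for i A
      using small_core[OF lev1] by (simp add: small_def)
    have step: "w (Suc i) A \<le> w i A" and strict: "w (Suc i) A < w i A"
      if "core n (level n k (Suc i)) (f A) \<noteq> core n (level n k i) (f A)" for i A
      using weight_core_less[OF lev1 level_mono that] by (simp_all add: w_def)
    have step: "w (Suc i) A \<le> w i A" for i A
      using step[of i A] by (cases "core n (level n k (Suc i)) (f A) = core n (level n k i) (f A)") (auto simp: w_def)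
    have "v i \<in> B i" for i
    proof -
      have "set_mset (v i) \<subseteq> {..n}"
        using I fin by (auto simp: v_def w_def weight_def set_mset_sum)
      moreover have "size (v i) = (\<Sum>A\<in>I. card (core n (level n k i) (f A)))"
        by (simp add: v_def w_def weight_def size_multiset_sum)
      moreover have "\<dots> \<le> (\<Sum>A\<in>I. level n k i ^ n)"
        using small_core[OF lev1] by (intro sum_mono) (auto simp: small_def)
      ultimately show ?thesis by (simp add: B_def)
    qed
    moreover have "v (Suc i) \<le> v i" for i unfolding v_def by (rule sum_mono) (rule step)
    ultimately obtain i where i: "i < L" "v (Suc i) = v i" using L[of v] by blast
    have "core n (level n k (Suc i)) (f A) = core n (level n k i) (f A)" if "A \<in> I" for A
    proof (rule ccontr)
      assume "\<not> ?thesis"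
      then have "w (Suc i) A < w i A" by (rule strict)
      then have "v (Suc i) < v i" unfolding v_def
        using I that step by (intro sum_strict_mono_ex1) auto
      then show False using i by simp
    qed
    then show ?thesis using i by blast
  qed
  then show ?thesis by blast
qed

section \<open>Extending a match in one coordinate\<close>

lemma finite_supp: "f \<in> Ggrp n \<Longrightarrow> finite (supp f)"
  by (simp add: Ggrp_def Vgrp_def)

lemma Ggrp_fcard: "f \<in> Ggrp n \<Longrightarrow> f u \<noteq> 0 \<Longrightarrow> fcard u = n"
  by (simp add: Ggrp_def supp_def)

lemma Ggrp_add:
  assumes "f \<in> Ggrp n" "g \<in> Ggrp n"
  shows "f + g \<in> Ggrp n"
proof -
  have "supp (f + g) \<subseteq> supp f \<union> supp g" by (auto simp: supp_def)
  moreover have "finite (supp f \<union> supp g)" using assms by (simp add: finite_supp)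
  ultimately have "finite (supp (f + g))" by (rule finite_subset)
  then show ?thesis
    using \<open>supp (f + g) \<subseteq> supp f \<union> supp g\<close> assms unfolding Ggrp_def Vgrp_def by blast
qed

lemma fun_add_self [simp]: "(f :: 'c \<Rightarrow> bit) + (f + g) = g" "(f :: 'c \<Rightarrow> bit) + f = 0"
proof -
  have *: "x + (x + y) = y" "x + x = 0" for x y :: bit by (cases x; cases y; simp)+
  show "f + (f + g) = g" "f + f = 0" by (auto simp: fun_eq_iff * simp del: add_bit_eq_xor)
qed

text \<open>
  Supersets of \<open>s\<close> with \<open>n\<close> elements, all of whose new elements are at least \<open>b\<close>; for different \<open>t\<close>
  the new elements come from disjoint intervals, so that the petals form a sunflower with kernel \<open>s\<close>.
\<close>

definition petal :: "nat \<Rightarrow> nat \<Rightarrow> nat fset \<Rightarrow> nat \<Rightarrow> nat fset" where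
  "petal n b s t = s |\<union>| Abs_fset {b + t * n ..< b + t * n + (n - fcard s)}"

lemma fset_petal: "fset (petal n b s t) = fset s \<union> {b + t * n ..< b + t * n + (n - fcard s)}"
  by (simp add: petal_def Abs_fset_inverse)

lemma fcard_petal:
  assumes "fset s \<subseteq> {..<b}" "fcard s \<le> n"
  shows "fcard (petal n b s t) = n"
proof -
  have "fcard (petal n b s t) = card (fset s \<union> {b + t * n ..< b + t * n + (n - fcard s)})"
    by (simp add: fcard.rep_eq fset_petal)
  also have "\<dots> = fcard s + (n - fcard s)"
    using assms(1) by (subst card_Un_disjoint) (auto simp: fcard.rep_eq)
  finally show ?thesis using assms(2) by simp
qed

lemma petal_inter:
  assumes "fset s \<subseteq> {..<b}" "t \<noteq> t'" "fcard s \<le> n" "r |\<subseteq>| petal n b s t" "r |\<subseteq>| petal n b s t'"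
  shows "r |\<subseteq>| s"
proof -
  have disj: "{b + t * n ..< b + t * n + n} \<inter> {b + t' * n ..< b + t' * n + n} = {}"
  proof (cases "t < t'")
    case True
    then have "Suc t * n \<le> t' * n" by (intro mult_le_mono1) simp
    then show ?thesis by auto
  next
    case False
    then have "Suc t' * n \<le> t * n" using assms(2) by (intro mult_le_mono1) simp
    then show ?thesis by auto
  qed
  have "fset r \<subseteq> fset s"
  proof
    fix x assume "x \<in> fset r"
    then have x: "x \<in> fset (petal n b s t)" "x \<in> fset (petal n b s t')"
      using assms(4,5) by (auto simp: less_eq_fset.rep_eq)
    show "x \<in> fset s"
    proof (rule ccontr)
      assume "x \<notin> fset s"
      then have "x \<in> {b + t * n ..< b + t * n + n} \<inter> {b + t' * n ..< b + t' * n + n}"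
        using x unfolding fset_petal by auto
      then show False using disj by blast
    qed
  qed
  then show ?thesis by (simp add: less_eq_fset.rep_eq)
qed

text \<open>
  A set below two petals lies below \<open>s\<close>. So if no member of \<open>F\<close> lies below \<open>s\<close>, each member covers at
  most one of the \<open>k + 1\<close> petals.
\<close>

lemma petals_not_covered:
  assumes s: "fset s \<subseteq> {..<b}" "fcard s \<le> n" and F: "small k F" "\<not> (\<exists>r\<in>F. r |\<subseteq>| s)"
  shows "\<exists>t\<le>k. \<not> (\<exists>r\<in>F. r |\<subseteq>| petal n b s t)"
proof (rule ccontr)
  assume "\<not> ?thesis"
  then have "\<forall>t. \<exists>r. t \<le> k \<longrightarrow> r \<in> F \<and> r |\<subseteq>| petal n b s t" by blast
  then obtain r where r: "\<And>t. t \<le> k \<Longrightarrow> r t \<in> F \<and> r t |\<subseteq>| petal n b s t" by metis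
  have "inj_on r {..k}"
  proof (rule inj_onI, rule ccontr)
    fix t t' assume t: "t \<in> {..k}" "t' \<in> {..k}" "r t = r t'" "t \<noteq> t'"
    then have "r t |\<subseteq>| s" using petal_inter[OF s(1) t(4) s(2)] r[of t] r[of t'] by simp
    then show False using F(2) r[of t] t(1) by auto
  qed
  moreover have "r ` {..k} \<subseteq> F" using r by auto
  moreover have "finite F" using F(1) by (simp add: small_def)
  ultimately have "card {..k} \<le> card F" by (metis card_image card_mono)
  then show False using F(1) by (simp add: small_def)
qed

text \<open>
  The answer \<open>\<zeta>'\<close> is defined separately at each \<open>n\<close>-element set \<open>u\<close>, with \<open>D A\<close> the core of
  \<open>\<zeta> + \<sigma> A\<close>. If \<open>u\<close> is not above \<open>D A\<close> for some \<open>A\<close>, then \<open>\<zeta>' u = \<sigma>' A u\<close> is forced; different \<open>A\<close>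
  force the same value because \<open>D A \<union> D B\<close> covers \<open>\<sigma> A + \<sigma> B\<close> and hence \<open>\<sigma>' A + \<sigma>' B\<close>. Otherwise \<open>u\<close>
  is free: if it belongs to some \<open>D A\<close>, then \<open>\<zeta>'\<close> has to differ from \<open>\<sigma>' A\<close> there, and on the petals over
  core elements \<open>\<zeta>'\<close> is \<open>1\<close>.

  The forced values make \<open>D A\<close> a cover of \<open>\<zeta>' + \<sigma>' A\<close>, which yields all required covers. That there
  are no others is shown for each \<open>s\<close> in \<open>D A\<close>: a small family that covers \<open>\<zeta>' + \<sigma>' A\<close> has a member
  below \<open>s\<close>. If \<open>s\<close> is not above some \<open>D B\<close>, this comes from \<open>\<sigma> A + \<sigma> B\<close> and the stationarity of the
  core; if \<open>s\<close> is free and has \<open>n\<close> elements, from the value at \<open>s\<close>; and in the remaining case from the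
  petals over \<open>s\<close>.
\<close>

lemma match_at_stationary_level:
  fixes \<sigma> \<sigma>' :: "'i \<Rightarrow> nat fset \<Rightarrow> bit" and \<zeta> :: "nat fset \<Rightarrow> bit"
  assumes I: "finite I"
    and \<sigma>: "\<And>A. A \<in> I \<Longrightarrow> \<sigma> A \<in> Ggrp n" and \<sigma>': "\<And>A. A \<in> I \<Longrightarrow> \<sigma>' A \<in> Ggrp n"
    and \<zeta>: "\<zeta> \<in> Ggrp n"
    and lev: "1 \<le> l" "k \<le> l" "k + l ^ n \<le> l'"
    and stat: "\<And>A. A \<in> I \<Longrightarrow> core n l' (\<zeta> + \<sigma> A) = core n l (\<zeta> + \<sigma> A)"
    and k': "k + 2 * l ^ n \<le> k'"
    and agree: "\<And>A B F. A \<in> I \<Longrightarrow> B \<in> I \<Longrightarrow> small k' F \<Longrightarrow>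
      covers F (\<sigma> A + \<sigma> B) \<longleftrightarrow> covers F (\<sigma>' A + \<sigma>' B)"
  shows "\<exists>\<zeta>'\<in>Ggrp n. \<forall>A\<in>I. \<forall>F. small k F \<longrightarrow> covers F (\<zeta> + \<sigma> A) = covers F (\<zeta>' + \<sigma>' A)"
proof -
  define D where "D A = core n l (\<zeta> + \<sigma> A)" for A
  define above where "above u A \<longleftrightarrow> (\<exists>s\<in>D A. s |\<subseteq>| u)" for u A
  have G: "\<zeta> + \<sigma> A \<in> Ggrp n" if "A \<in> I" for A using Ggrp_add \<zeta> \<sigma> that by blast
  have smallD: "small (l ^ n) (D A)" for A using small_core lev(1) by (simp add: D_def)
  have finD: "finite (D A)" for A using smallD by (simp add: small_def)
  have covD: "covers (D A) (\<zeta> + \<sigma> A)" if "A \<in> I" for A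
    unfolding D_def using covers_core G that by blast
  have cardD: "fcard s \<le> n" if "s \<in> D A" for s A using that by (simp add: D_def core_def)
  have diff: "(\<zeta> + \<sigma> A) + (\<zeta> + \<sigma> B) = \<sigma> A + \<sigma> B" for A B
    using fun_add_self(1)[of \<zeta> "\<sigma> A + \<sigma> B"] by (simp add: ac_simps del: fun_add_self)
  have covAB: "covers (D A \<union> D B) (\<sigma>' A + \<sigma>' B)" if "A \<in> I" "B \<in> I" for A B
  proof -
    have "covers (D A \<union> D B) (\<sigma> A + \<sigma> B)"
      using covers_add[OF covD[OF that(1)] covD[OF that(2)]] by (simp add: diff)
    moreover have "small k' (D A \<union> D B)"
      using small_Un[OF smallD smallD] small_mono k' by (metis add_leD2 mult_2)
    ultimately show ?thesis using agree that by blast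
  qed
  have eq_off: "\<sigma>' A u = \<sigma>' B u" if "A \<in> I" "B \<in> I" "\<not> above u A" "\<not> above u B" for A B u
    using covAB[OF that(1,2)] that(3,4) unfolding covers_def above_def
    by (metis Un_iff bit_add_eq_0_iff plus_fun_apply)
  \<comment> \<open>At a core element of full size both \<open>\<zeta> + \<sigma> A\<close> and \<open>\<zeta> + \<sigma> B\<close> are nonzero, so \<open>\<sigma> A\<close> and \<open>\<sigma> B\<close>
    agree there; the remaining core elements then cover \<open>\<sigma> A + \<sigma> B\<close> without covering \<open>u\<close>.\<close>
  have eq_top: "\<sigma>' A u = \<sigma>' B u"
    if AB: "A \<in> I" "B \<in> I" and u: "u \<in> D A" "u \<in> D B" "fcard u = n" for A B u
  proof -
    have "(\<zeta> + \<sigma> C) u \<noteq> 0" if "C \<in> I" "u \<in> D C" for C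
      using core_top_in_support[OF G[OF that(1)] lev(1)] lev(3) stat[OF that(1)] that(2) u(3)
      unfolding D_def by (metis add_leD2)
    then have ne: "\<zeta> u \<noteq> \<sigma> A u" "\<zeta> u \<noteq> \<sigma> B u" using AB u by (metis bit_add_eq_0_iff plus_fun_apply)+
    then have same: "\<sigma> A u = \<sigma> B u" by (metis bit_not_one_iff)
    let ?F = "(D A \<union> D B) - {u}"
    have "covers (D A \<union> D B) (\<sigma> A + \<sigma> B)"
      using covers_add[OF covD[OF AB(1)] covD[OF AB(2)]] by (simp add: diff)
    have "covers ?F (\<sigma> A + \<sigma> B)" unfolding covers_def
    proof (intro allI impI)
      fix v assume v: "(\<sigma> A + \<sigma> B) v \<noteq> 0"
      then obtain s where s: "s \<in> D A \<union> D B" "s |\<subseteq>| v"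
        using \<open>covers (D A \<union> D B) (\<sigma> A + \<sigma> B)\<close> unfolding covers_def by blast
      have "fcard v = n" using Ggrp_fcard[OF Ggrp_add[OF \<sigma>[OF AB(1)] \<sigma>[OF AB(2)]] v] .
      moreover have "v \<noteq> u" using v same by (metis bit_add_eq_0_iff plus_fun_apply)
      ultimately have "s \<noteq> u" using s(2) u(3) fcard_seteq[of u v] by auto
      then show "\<exists>s\<in>?F. s |\<subseteq>| v" using s by blast
    qed
    moreover have "small k' ?F"
    proof -
      have "small (l ^ n + l ^ n) (D A \<union> D B)" using small_Un[OF smallD smallD] .
      then have "small (l ^ n + l ^ n) ?F" unfolding small_def
        by (meson card_Diff1_le finite_Diff le_trans)
      then show ?thesis by (rule small_mono) (use k' in simp)
    qed
    ultimately have "covers ?F (\<sigma>' A + \<sigma>' B)" using agree AB by blast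
    moreover have "\<not> s |\<subseteq>| u" if "s \<in> ?F" for s
      using that u(1,2) core_antichain[of u n l _ s] unfolding D_def by blast
    ultimately show ?thesis unfolding covers_def by (metis bit_add_eq_0_iff plus_fun_apply)
  qed
  \<comment> \<open>All elements of sets in the supports and cores at hand are below \<open>b\<close>, so petals avoid them.\<close>
  define b where "b = Suc (Max (insert 0 (\<Union>u\<in>(\<Union>A\<in>I. supp (\<sigma>' A) \<union> D A). fset u)))"
  have finb: "finite (\<Union>u\<in>(\<Union>A\<in>I. supp (\<sigma>' A) \<union> D A). fset u)"
    using I finD finite_supp[OF \<sigma>'] by auto
  have lt_b: "x < b" if "x \<in> fset u" "u \<in> supp (\<sigma>' A) \<or> u \<in> D A" "A \<in> I" for x u A
  proof -
    have "x \<in> (\<Union>u\<in>(\<Union>A\<in>I. supp (\<sigma>' A) \<union> D A). fset u)" using that by blast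
    then show ?thesis unfolding b_def using Max_ge[OF _ insertI2] finb by (simp add: less_Suc_eq_le)
  qed
  define Pet where "Pet = (\<Union>A\<in>I. \<Union>s\<in>{s \<in> D A. fcard s < n}. petal n b s ` {..k})"
  have finPet: "finite Pet" unfolding Pet_def using I finD by auto
  have Pet_new: "u \<notin> D B" "\<sigma>' B u = 0" if u: "u \<in> Pet" and B: "B \<in> I" for u B
  proof -
    obtain A s t where "s \<in> D A" "fcard s < n" "u = petal n b s t" using u by (auto simp: Pet_def)
    then have "b + t * n \<in> fset u" unfolding \<open>u = _\<close> fset_petal Un_iff atLeastLessThan_iff by linarith
    then have "u \<notin> supp (\<sigma>' B)" "u \<notin> D B" using lt_b[of "b + t * n" u B] B by auto
    then show "u \<notin> D B" "\<sigma>' B u = 0" by (simp_all add: supp_def)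
  qed
  have Pet_card: "fcard u = n" if u: "u \<in> Pet" for u
  proof -
    obtain A s t where s: "A \<in> I" "s \<in> D A" "fcard s < n" "u = petal n b s t" using u by (auto simp: Pet_def)
    then have "fset s \<subseteq> {..<b}" using lt_b by blast
    then show ?thesis using fcard_petal s by simp
  qed
  \<comment> \<open>The requirements on the value \<open>v\<close> of \<open>\<zeta>'\<close> at \<open>u\<close>; the last one keeps the support finite.\<close>
  define Q where "Q u v \<longleftrightarrow>
      (\<forall>A\<in>I. \<not> above u A \<longrightarrow> v = \<sigma>' A u) \<and>
      ((\<forall>A\<in>I. above u A) \<longrightarrow>
        (\<forall>A\<in>I. u \<in> D A \<longrightarrow> fcard u = n \<longrightarrow> v \<noteq> \<sigma>' A u) \<and> (u \<in> Pet \<longrightarrow> v = 1)) \<and>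
      (v \<noteq> 0 \<longrightarrow> fcard u = n \<and> (u \<in> Pet \<or> (\<exists>A\<in>I. u \<in> supp (\<sigma>' A) \<or> u \<in> D A)))" for u v
  have "\<exists>v. Q u v" for u
  proof (cases "\<forall>A\<in>I. above u A")
    case False
    then obtain A where A: "A \<in> I" "\<not> above u A" by blast
    have "Q u (\<sigma>' A u)" unfolding Q_def
    proof (intro conjI impI ballI)
      fix B assume "B \<in> I" "\<not> above u B"
      then show "\<sigma>' A u = \<sigma>' B u" using eq_off A by blast
    next
      assume ne: "\<sigma>' A u \<noteq> 0"
      show "fcard u = n" using Ggrp_fcard[OF \<sigma>'[OF A(1)] ne] .
      have "u \<in> supp (\<sigma>' A)" using ne by (simp add: supp_def)
      then show "u \<in> Pet \<or> (\<exists>A\<in>I. u \<in> supp (\<sigma>' A) \<or> u \<in> D A)" using A(1) by blast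
    qed (use A in blast)+
    then show ?thesis by blast
  next
    case all: True
    show ?thesis
    proof (cases "fcard u = n \<and> (\<exists>A\<in>I. u \<in> D A)")
      case True
      then obtain A where A: "A \<in> I" "u \<in> D A" "fcard u = n" by blast
      have "Q u (1 + \<sigma>' A u)" unfolding Q_def
      proof (intro conjI impI ballI)
        fix B assume B: "B \<in> I" "u \<in> D B"
        then have "\<sigma>' A u = \<sigma>' B u" using eq_top A by blast
        then show "1 + \<sigma>' A u \<noteq> \<sigma>' B u" by (cases "\<sigma>' B u") auto
      qed (use A all Pet_new in blast)+
      then show ?thesis by blast
    next
      case False
      have "Q u (if u \<in> Pet then 1 else 0)"
        unfolding Q_def
      proof (intro conjI impI ballI)
        assume "(if u \<in> Pet then 1 else 0) \<noteq> (0 :: bit)"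
        then have "u \<in> Pet" by (simp split: if_splits)
        then show "fcard u = n" "u \<in> Pet \<or> (\<exists>A\<in>I. u \<in> supp (\<sigma>' A) \<or> u \<in> D A)"
          using Pet_card by blast+
      qed (use False all in simp_all)
      then show ?thesis by blast
    qed
  qed
  then obtain \<zeta>' where Q: "\<And>u. Q u (\<zeta>' u)" by metis
  have "supp \<zeta>' \<subseteq> Pet \<union> (\<Union>A\<in>I. supp (\<sigma>' A) \<union> D A)"
  proof
    fix u assume "u \<in> supp \<zeta>'"
    then have "\<zeta>' u \<noteq> 0" by (simp add: supp_def)
    then show "u \<in> Pet \<union> (\<Union>A\<in>I. supp (\<sigma>' A) \<union> D A)" using Q[of u] unfolding Q_def by blast
  qed
  moreover have "finite (Pet \<union> (\<Union>A\<in>I. supp (\<sigma>' A) \<union> D A))"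
    using finPet I finD finite_supp[OF \<sigma>'] by auto
  ultimately have "finite (supp \<zeta>')" by (rule finite_subset)
  moreover have "fcard u = n" if "u \<in> supp \<zeta>'" for u
    using Q[of u] that unfolding Q_def by (simp add: supp_def)
  ultimately have Gz: "\<zeta>' \<in> Ggrp n" by (simp add: Ggrp_def Vgrp_def)
  have off: "\<zeta>' u = \<sigma>' A u" if "A \<in> I" "\<not> above u A" for u A
    using Q[of u] that unfolding Q_def by blast
  have "covers F (\<zeta> + \<sigma> A) \<longleftrightarrow> covers F (\<zeta>' + \<sigma>' A)" if A: "A \<in> I" and F: "small k F" for A F
  proof
    assume c: "covers F (\<zeta> + \<sigma> A)"
    have "covers (D A) (\<zeta>' + \<sigma>' A)" unfolding covers_def
    proof (intro allI impI)
      fix u assume "(\<zeta>' + \<sigma>' A) u \<noteq> 0"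
      then have "\<zeta>' u \<noteq> \<sigma>' A u" by (metis bit_add_eq_0_iff plus_fun_apply)
      then show "\<exists>s\<in>D A. s |\<subseteq>| u" using off[OF A] unfolding above_def by blast
    qed
    moreover have "\<exists>t\<in>F. t |\<subseteq>| s" if "s \<in> D A" for s
      using core_below_cover[OF small_mono[OF F lev(2)] c] that unfolding D_def by blast
    ultimately show "covers F (\<zeta>' + \<sigma>' A)" by (rule covers_refine)
  next
    assume c': "covers F (\<zeta>' + \<sigma>' A)"
    have "\<exists>r\<in>F. r |\<subseteq>| s" if s: "s \<in> D A" for s
    proof (rule ccontr)
      assume no: "\<not> ?thesis"
      show False
      proof (cases "\<forall>B\<in>I. above s B")
        case False
        then obtain B where B: "B \<in> I" "\<not> above s B" by blast
        have "covers (F \<union> D B) (\<sigma>' A + \<sigma>' B)" unfolding covers_def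
        proof (intro allI impI)
          fix u assume u: "(\<sigma>' A + \<sigma>' B) u \<noteq> 0"
          show "\<exists>r\<in>F \<union> D B. r |\<subseteq>| u"
          proof (cases "above u B")
            case True
            then show ?thesis unfolding above_def by blast
          next
            case False
            then have "(\<zeta>' + \<sigma>' A) u \<noteq> 0" using off[OF B(1) False] u
              by (metis add.commute plus_fun_apply)
            then show ?thesis using c' unfolding covers_def by blast
          qed
        qed
        moreover have sm: "small (k + l ^ n) (F \<union> D B)" using small_Un[OF F smallD] .
        then have "small k' (F \<union> D B)" by (rule small_mono) (use k' in simp)
        ultimately have "covers (F \<union> D B) (\<sigma> A + \<sigma> B)" using agree A B by blast
        then have "covers ((F \<union> D B) \<union> D B) ((\<sigma> A + \<sigma> B) + (\<zeta> + \<sigma> B))"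
          using covD[OF B(1)] by (rule covers_add)
        moreover have "(\<sigma> A + \<sigma> B) + (\<zeta> + \<sigma> B) = \<zeta> + \<sigma> A"
          using fun_add_self(1)[of "\<sigma> B" "\<zeta> + \<sigma> A"] by (simp add: ac_simps del: fun_add_self)
        moreover have "(F \<union> D B) \<union> D B = F \<union> D B" by blast
        ultimately have "covers (F \<union> D B) (\<zeta> + \<sigma> A)" by simp
        moreover have "small l' (F \<union> D B)" using sm lev(3) by (rule small_mono)
        moreover have "s \<in> core n l' (\<zeta> + \<sigma> A)" using s stat A by (simp add: D_def)
        ultimately obtain t where "t \<in> F \<union> D B" "t |\<subseteq>| s" using core_below_cover by blast
        then show False using no B(2) unfolding above_def by blast
      next
        case all: True
        show False
        proof (cases "fcard s < n")
          case False
          then have "\<zeta>' s \<noteq> \<sigma>' A s" using Q[of s] all A s cardD[OF s] unfolding Q_def by auto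
          then have "(\<zeta>' + \<sigma>' A) s \<noteq> 0" by (metis bit_add_eq_0_iff plus_fun_apply)
          then show False using c' no unfolding covers_def by blast
        next
          case True
          have sb: "fset s \<subseteq> {..<b}" using lt_b s A by blast
          obtain t where t: "t \<le> k" "\<not> (\<exists>r\<in>F. r |\<subseteq>| petal n b s t)"
            using petals_not_covered[OF sb cardD[OF s] F no] by blast
          let ?u = "petal n b s t"
          have u: "?u \<in> Pet" unfolding Pet_def using A s True t(1) by blast
          have "s |\<subseteq>| ?u" by (simp add: petal_def)
          then have "\<forall>B\<in>I. above ?u B" using all unfolding above_def by (meson order_trans)
          then have "\<zeta>' ?u = 1" using Q[of ?u] u unfolding Q_def by blast
          then have "(\<zeta>' + \<sigma>' A) ?u \<noteq> 0" using Pet_new(2)[OF u A] by simp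
          then show False using c' t(2) unfolding covers_def by blast
        qed
      qed
    qed
    then show "covers F (\<zeta> + \<sigma> A)" using covers_refine[OF covD[OF A]] by blast
  qed
  then show ?thesis using Gz by blast
qed

text \<open>
  Only the sums \<open>\<sigma> A + \<sigma> B\<close> have to match beforehand: the group has characteristic two, so these are the
  differences that the Chinese remainder argument compares.
\<close>

lemma extend_coordinate:
  assumes I: "finite I"
  shows "\<exists>k'. \<forall>(\<sigma> :: 'i \<Rightarrow> nat fset \<Rightarrow> bit) \<sigma>' \<zeta>.
    (\<forall>A\<in>I. \<sigma> A \<in> Ggrp n \<and> \<sigma>' A \<in> Ggrp n) \<longrightarrow> \<zeta> \<in> Ggrp n \<longrightarrow>
    (\<forall>A\<in>I. \<forall>B\<in>I. \<forall>F. small k' F \<longrightarrow> covers F (\<sigma> A + \<sigma> B) = covers F (\<sigma>' A + \<sigma>' B)) \<longrightarrow>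
    (\<exists>\<zeta>'\<in>Ggrp n. \<forall>A\<in>I. \<forall>F. small k F \<longrightarrow> covers F (\<zeta> + \<sigma> A) = covers F (\<zeta>' + \<sigma>' A))"
proof -
  obtain L where L: "\<And>f :: 'i \<Rightarrow> nat fset \<Rightarrow> bit.
      \<exists>i<L. \<forall>A\<in>I. core n (level n k (Suc i)) (f A) = core n (level n k i) (f A)"
    using stationary_level[OF I, of n k] by blast
  let ?k' = "k + 2 * level n k L ^ n"
  have "\<exists>\<zeta>'\<in>Ggrp n. \<forall>A\<in>I. \<forall>F. small k F \<longrightarrow> covers F (\<zeta> + \<sigma> A) = covers F (\<zeta>' + \<sigma>' A)"
    if "\<forall>A\<in>I. \<sigma> A \<in> Ggrp n \<and> \<sigma>' A \<in> Ggrp n" "\<zeta> \<in> Ggrp n"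
      "\<forall>A\<in>I. \<forall>B\<in>I. \<forall>F. small ?k' F \<longrightarrow> covers F (\<sigma> A + \<sigma> B) = covers F (\<sigma>' A + \<sigma>' B)"
    for \<sigma> \<sigma>' :: "'i \<Rightarrow> nat fset \<Rightarrow> bit" and \<zeta>
  proof -
    obtain i where i: "i < L"
      "\<forall>A\<in>I. core n (level n k (Suc i)) (\<zeta> + \<sigma> A) = core n (level n k i) (\<zeta> + \<sigma> A)"
      using L[of "\<lambda>A. \<zeta> + \<sigma> A"] by blast
    have "level n k i ^ n \<le> level n k L ^ n" using i(1) by (intro power_mono level_mono) auto
    then show ?thesis
      using match_at_stationary_level[OF I, of \<sigma> n \<sigma>' \<zeta> "level n k i" k "level n k (Suc i)" ?k']
        that i(2) level_ge[of k n i] by simp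
  qed
  then show ?thesis by blast
qed

section \<open>Back and forth\<close>

text \<open>
  The default \<open>0\<close> at elements of \<open>\<omega>\<close> makes a sum over a set of variables range over those whose
  values lie in \<open>G\<^sub>\<omega>\<close>.
\<close>

definition vec :: "melem \<Rightarrow> nat \<Rightarrow> nat fset \<Rightarrow> bit" where
  "vec x = (case x of Inl \<eta> \<Rightarrow> \<eta> | Inr m \<Rightarrow> 0)"

lemma vec_simps [simp]: "vec (Inl \<eta>) = \<eta>" "vec (Inr m) = 0"
  by (simp_all add: vec_def)

definition vsum :: "(nat \<Rightarrow> melem) \<Rightarrow> nat set \<Rightarrow> nat \<Rightarrow> nat fset \<Rightarrow> bit" where
  "vsum e A = (\<Sum>j\<in>A. vec (e j))"

lemma univ_M: "univ Mstruct = Gomega <+> UNIV"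
  by (simp add: Mstruct_def)

lemma vec_in_Gomega: "x \<in> univ Mstruct \<Longrightarrow> vec x \<in> Gomega"
  using zero_in_Gomega by (auto simp: univ_M)

lemma vsum_in_Gomega:
  assumes "\<And>j. e j \<in> univ Mstruct"
  shows "vsum e A \<in> Gomega"
proof (induction A rule: infinite_finite_induct)
  case (infinite A)
  then show ?case unfolding vsum_def sum.infinite[OF infinite] by (intro zero_in_Gomega)
next
  case empty
  show ?case unfolding vsum_def by (simp only: sum.empty zero_in_Gomega)
next
  case (insert j A)
  then have "vsum e (insert j A) = vec (e j) + vsum e A"
    unfolding vsum_def by (intro sum.insert)
  then show ?case using plus_in_Gomega[OF vec_in_Gomega[OF assms] insert.IH] by (simp only:)
qed

lemma gomega_add_self [simp]:
  "(f :: nat \<Rightarrow> nat fset \<Rightarrow> bit) + (f + g) = g" "(f :: nat \<Rightarrow> nat fset \<Rightarrow> bit) + f = 0"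
  by (simp_all add: fun_eq_iff del: add_bit_eq_xor plus_fun_apply)
     (simp_all add: plus_fun_def[of "f :: nat \<Rightarrow> nat fset \<Rightarrow> bit" for f] fun_add_self)

lemma gomega_add_eq_0_iff: "(f :: nat \<Rightarrow> nat fset \<Rightarrow> bit) + g = 0 \<longleftrightarrow> f = g"
  by (metis add.right_neutral gomega_add_self)

lemma vsum_sym_diff:
  assumes "finite A" "finite B"
  shows "vsum e A + vsum e B = vsum e ((A - B) \<union> (B - A))"
proof -
  have A: "vsum e A = vsum e (A \<inter> B) + vsum e (A - B)"
    unfolding vsum_def using assms
    by (subst sum.union_disjoint[symmetric]) (auto intro: sum.cong)
  have B: "vsum e B = vsum e (A \<inter> B) + vsum e (B - A)"
    unfolding vsum_def using assms
    by (subst sum.union_disjoint[symmetric]) (auto intro: sum.cong)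
  have "vsum e ((A - B) \<union> (B - A)) = vsum e (A - B) + vsum e (B - A)"
    unfolding vsum_def using assms by (subst sum.union_disjoint) auto
  moreover have "vsum e A + vsum e B = vsum e (A \<inter> B) + (vsum e (A \<inter> B) + (vsum e (A - B) + vsum e (B - A)))"
    unfolding A B by (simp add: ac_simps del: gomega_add_self fun_add_self)
  ultimately show ?thesis by simp
qed

text \<open>
  The invariant of the back-and-forth game on the first \<open>N\<close> variables. Since a value in \<open>\<omega>\<close> must be
  literally the same on both sides, a move in \<open>\<omega>\<close> is answered by the same element; permutations of \<open>\<omega>\<close>
  are dealt with separately, as automorphisms.
\<close>

definition sim :: "nat \<Rightarrow> nat \<Rightarrow> nat \<Rightarrow> (nat \<Rightarrow> melem) \<Rightarrow> (nat \<Rightarrow> melem) \<Rightarrow> bool" where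
  "sim N K k e e' \<longleftrightarrow>
     (\<forall>j<N. \<forall>m. e j = Inr m \<longleftrightarrow> e' j = Inr m) \<and>
     (\<forall>A\<subseteq>{..<N}. (vsum e A = 0 \<longleftrightarrow> vsum e' A = 0) \<and>
       (\<forall>n<K. \<forall>F. small k F \<longrightarrow> covers F (vsum e A n) = covers F (vsum e' A n)))"

lemma sim_sym: "sim N K k e e' \<Longrightarrow> sim N K k e' e"
  by (simp add: sim_def)

lemma sim_antimono:
  assumes "sim N K l e e'" "k \<le> l"
  shows "sim N K k e e'"
  unfolding sim_def
proof (intro conjI allI impI)
  fix A n F assume "A \<subseteq> {..<N}" "n < K" "small k (F :: nat fset set)"
  moreover from this have "small l F" using assms(2) small_mono by blast
  ultimately show "covers F (vsum e A n) = covers F (vsum e' A n)"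
    using assms(1) by (simp add: sim_def)
qed (use assms(1) in \<open>simp_all add: sim_def\<close>)

text \<open>
  Quantified variables are bounded by \<open>N\<close> as well, since the back-and-forth game assigns values to them.
\<close>

fun bounded_by :: "nat \<Rightarrow> nat \<Rightarrow> lfm \<Rightarrow> bool" where
  "bounded_by N K (Eq s t) \<longleftrightarrow> tvars s \<union> tvars t \<subseteq> {..<N}"
| "bounded_by N K (PredP t) \<longleftrightarrow> tvars t \<subseteq> {..<N}"
| "bounded_by N K (PredQ t) \<longleftrightarrow> tvars t \<subseteq> {..<N}"
| "bounded_by N K (RelR n s t) \<longleftrightarrow> n < K \<and> tvars s \<union> tvars t \<subseteq> {..<N}"
| "bounded_by N K (Neg \<phi>) \<longleftrightarrow> bounded_by N K \<phi>"
| "bounded_by N K (Conj \<phi> \<psi>) \<longleftrightarrow> bounded_by N K \<phi> \<and> bounded_by N K \<psi>"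
| "bounded_by N K (Ex j \<phi>) \<longleftrightarrow> j < N \<and> bounded_by N K \<phi>"

lemma bounded_by_mono:
  assumes "bounded_by N K \<phi>" "N \<le> N'" "K \<le> K'"
  shows "bounded_by N' K' \<phi>"
proof -
  have "{..<N} \<subseteq> {..<N'}" using assms(2) by simp
  then have "A \<subseteq> {..<N} \<Longrightarrow> A \<subseteq> {..<N'}" for A by (rule order_trans[rotated])
  then show ?thesis using assms by (induction \<phi>) simp_all
qed

lemma finite_tvars: "finite (tvars t)"
  by (induction t) auto

lemma finite_fvars: "finite (fvars \<phi>)"
  by (induction \<phi>) (auto simp: finite_tvars)

lemma ex_bounded_by: "\<exists>N K. bounded_by N K \<phi>"
proof (induction \<phi>)
  case (Eq s t)
  then show ?case using finite_nat_iff_bounded[of "tvars s \<union> tvars t"] by (simp add: finite_tvars)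
next
  case (PredP t)
  then show ?case using finite_nat_iff_bounded[of "tvars t"] by (simp add: finite_tvars)
next
  case (PredQ t)
  then show ?case using finite_nat_iff_bounded[of "tvars t"] by (simp add: finite_tvars)
next
  case (RelR n s t)
  obtain N where "tvars s \<union> tvars t \<subseteq> {..<N}"
    using finite_nat_iff_bounded[of "tvars s \<union> tvars t"] by (auto simp: finite_tvars)
  then have "bounded_by N (Suc n) (RelR n s t)" by simp
  then show ?case by blast
next
  case (Neg \<phi>)
  then show ?case by simp
next
  case (Conj \<phi> \<psi>)
  then obtain N K N' K' where "bounded_by N K \<phi>" "bounded_by N' K' \<psi>" by blast
  then have "bounded_by (max N N') (max K K') (Conj \<phi> \<psi>)"
    using bounded_by_mono by simp
  then show ?case by blast
next
  case (Ex j \<phi>)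
  then obtain N K where "bounded_by N K \<phi>" by blast
  then have "bounded_by (max N (Suc j)) K (Ex j \<phi>)" using bounded_by_mono by simp
  then show ?case by blast
qed

text \<open>
  In characteristic two a term is the sum over a set of variables, and addition of terms is symmetric
  difference of these sets. The set is the same on both sides because it only depends on the sorts.
\<close>

lemma tval_sim:
  assumes sort: "\<forall>j<N. \<forall>m. e j = Inr m \<longleftrightarrow> e' j = Inr m" and "tvars t \<subseteq> {..<N}"
  shows "(\<exists>m. tval Mstruct e t = Inr m \<and> tval Mstruct e' t = Inr m) \<or>
    (\<exists>A\<subseteq>{..<N}. tval Mstruct e t = Inl (vsum e A) \<and> tval Mstruct e' t = Inl (vsum e' A))"
  using assms(2)
proof (induction t)
  case (Var j)
  then have j: "j < N" by simp
  show ?case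
  proof (cases "e j")
    case (Inr m)
    then show ?thesis using sort j by simp
  next
    case (Inl \<eta>)
    then have "\<nexists>m. e' j = Inr m" using sort j by (metis Inl_Inr_False)
    then obtain \<eta>' where "e' j = Inl \<eta>'" by (meson sumE)
    then have "tval Mstruct e (Var j) = Inl (vsum e {j}) \<and> tval Mstruct e' (Var j) = Inl (vsum e' {j})"
      using Inl by (simp add: vsum_def)
    then show ?thesis using j by blast
  qed
next
  case Zero
  have "tval Mstruct e Zero = Inl (vsum e {}) \<and> tval Mstruct e' Zero = Inl (vsum e' {})"
    by (simp add: vsum_def Mstruct_def)
  then show ?case by blast
next
  case (Plus s t)
  have zero: ?case if "tval Mstruct e (Plus s t) = Inl 0" "tval Mstruct e' (Plus s t) = Inl 0"
  proof -
    have "tval Mstruct e (Plus s t) = Inl (vsum e {}) \<and> tval Mstruct e' (Plus s t) = Inl (vsum e' {})"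
      using that by (simp add: vsum_def)
    then show ?thesis by blast
  qed
  consider m where "tval Mstruct e s = Inr m" "tval Mstruct e' s = Inr m"
    | m where "tval Mstruct e t = Inr m" "tval Mstruct e' t = Inr m"
    | A B where "A \<subseteq> {..<N}" "tval Mstruct e s = Inl (vsum e A)" "tval Mstruct e' s = Inl (vsum e' A)"
      "B \<subseteq> {..<N}" "tval Mstruct e t = Inl (vsum e B)" "tval Mstruct e' t = Inl (vsum e' B)"
    using Plus by auto
  then show ?case
  proof cases
    case 1
    then show ?thesis by (intro zero) (simp_all add: Mstruct_def)
  next
    case 2
    then show ?thesis
      by (intro zero) (cases "tval Mstruct e s"; cases "tval Mstruct e' s"; simp add: Mstruct_def)+
  next
    case 3
    have "finite A" "finite B" using 3 finite_subset by blast+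
    then have "tval Mstruct e (Plus s t) = Inl (vsum e ((A - B) \<union> (B - A))) \<and>
        tval Mstruct e' (Plus s t) = Inl (vsum e' ((A - B) \<union> (B - A)))"
      using 3 by (simp add: Mstruct_def vsum_sym_diff)
    moreover have "(A - B) \<union> (B - A) \<subseteq> {..<N}" using 3 by blast
    ultimately show ?thesis by blast
  qed
qed

lemma intR_M: "(Inl \<eta>, Inr m) \<in> intR Mstruct n \<longleftrightarrow> \<eta> \<in> Gomega \<and> covers {{|m|}} (\<eta> n)"
proof -
  have "\<eta> \<in> Gomega \<Longrightarrow> \<eta> n \<in> Ggrp n" by (simp add: Gomega_def)
  then show ?thesis
    unfolding Mstruct_def Hsub_def Gsub_def covers_def Ggrp_def supp_def by auto
qed

lemma intR_M_sorts: "(x, y) \<in> intR Mstruct n \<Longrightarrow> \<exists>\<eta> m. x = Inl \<eta> \<and> y = Inr m"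
  by (auto simp: Mstruct_def)

lemma sat_atomic_sim:
  assumes e: "\<And>j. e j \<in> univ Mstruct" and e': "\<And>j. e' j \<in> univ Mstruct"
    and sim: "sim N K k e e'" and k: "1 \<le> k"
  shows "tvars s \<union> tvars t \<subseteq> {..<N} \<Longrightarrow> tval Mstruct e s = tval Mstruct e t \<longleftrightarrow> tval Mstruct e' s = tval Mstruct e' t"
    and "tvars t \<subseteq> {..<N} \<Longrightarrow> tval Mstruct e t \<in> intP Mstruct \<longleftrightarrow> tval Mstruct e' t \<in> intP Mstruct"
    and "tvars t \<subseteq> {..<N} \<Longrightarrow> tval Mstruct e t \<in> intQ Mstruct \<longleftrightarrow> tval Mstruct e' t \<in> intQ Mstruct"
    and "n < K \<Longrightarrow> tvars s \<union> tvars t \<subseteq> {..<N} \<Longrightarrow>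
      (tval Mstruct e s, tval Mstruct e t) \<in> intR Mstruct n \<longleftrightarrow> (tval Mstruct e' s, tval Mstruct e' t) \<in> intR Mstruct n"
proof -
  have vG: "vsum e A \<in> Gomega" "vsum e' A \<in> Gomega" for A
    using e e' by (intro vsum_in_Gomega; blast)+
  have sort: "\<forall>j<N. \<forall>m. e j = Inr m \<longleftrightarrow> e' j = Inr m" using sim by (simp add: sim_def)
  note tv = tval_sim[OF sort]
  {
    assume "tvars s \<union> tvars t \<subseteq> {..<N}"
    then have "tvars s \<subseteq> {..<N}" "tvars t \<subseteq> {..<N}" by simp_all
    from tv[OF this(1)] tv[OF this(2)]
    show "tval Mstruct e s = tval Mstruct e t \<longleftrightarrow> tval Mstruct e' s = tval Mstruct e' t"
    proof (elim disjE exE conjE)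
      fix A B assume AB: "A \<subseteq> {..<N}" "B \<subseteq> {..<N}"
        and *: "tval Mstruct e s = Inl (vsum e A)" "tval Mstruct e' s = Inl (vsum e' A)"
        "tval Mstruct e t = Inl (vsum e B)" "tval Mstruct e' t = Inl (vsum e' B)"
      have fin: "finite A" "finite B" using AB finite_subset by blast+
      have "(A - B) \<union> (B - A) \<subseteq> {..<N}" using AB by blast
      then have "vsum e ((A - B) \<union> (B - A)) = 0 \<longleftrightarrow> vsum e' ((A - B) \<union> (B - A)) = 0"
        using sim unfolding sim_def by blast
      then have "vsum e A + vsum e B = 0 \<longleftrightarrow> vsum e' A + vsum e' B = 0"
        by (simp only: vsum_sym_diff[OF fin])
      then show ?thesis using * by (simp add: gomega_add_eq_0_iff)
    qed simp_all
  }
  {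
    assume "tvars t \<subseteq> {..<N}"
    then show "tval Mstruct e t \<in> intP Mstruct \<longleftrightarrow> tval Mstruct e' t \<in> intP Mstruct"
      using tv[of t] vG by (auto simp: Mstruct_def)
  }
  {
    assume "tvars t \<subseteq> {..<N}"
    then show "tval Mstruct e t \<in> intQ Mstruct \<longleftrightarrow> tval Mstruct e' t \<in> intQ Mstruct"
      using tv[of t] by (auto simp: Mstruct_def)
  }
  {
    assume n: "n < K" and "tvars s \<union> tvars t \<subseteq> {..<N}"
    then have "tvars s \<subseteq> {..<N}" "tvars t \<subseteq> {..<N}" by simp_all
    from tv[OF this(1)] tv[OF this(2)]
    show "(tval Mstruct e s, tval Mstruct e t) \<in> intR Mstruct n \<longleftrightarrow>
        (tval Mstruct e' s, tval Mstruct e' t) \<in> intR Mstruct n"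
    proof (elim disjE exE conjE)
      fix A m assume A: "A \<subseteq> {..<N}"
        and *: "tval Mstruct e s = Inl (vsum e A)" "tval Mstruct e' s = Inl (vsum e' A)"
        "tval Mstruct e t = Inr m" "tval Mstruct e' t = Inr m"
      have "small k {{|m|}}" using k by (simp add: small_def)
      then have "covers {{|m|}} (vsum e A n) \<longleftrightarrow> covers {{|m|}} (vsum e' A n)"
        using sim A n unfolding sim_def by blast
      then show ?thesis using * vG by (simp add: intR_M)
    qed (use intR_M_sorts in fastforce)+
  }
qed

lemma infinite_Ggrp:
  assumes "0 < n"
  shows "infinite (Ggrp n)"
proof
  assume fin: "finite (Ggrp n)"
  let ?u = "\<lambda>m. Abs_fset {m..<m + n}"
  let ?f = "\<lambda>m v. if v = ?u m then 1 else (0 :: bit)"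
  have fset_u: "fset (?u m) = {m..<m + n}" for m by (simp add: Abs_fset_inverse)
  have "supp (?f m) = {?u m}" for m by (auto simp: supp_def)
  then have "?f m \<in> Ggrp n" for m
    by (auto simp: Ggrp_def Vgrp_def fcard.rep_eq fset_u)
  moreover have "inj ?f"
  proof (rule injI)
    fix m m' assume "?f m = ?f m'"
    then have "?f m (?u m) = ?f m' (?u m)" by (rule fun_cong)
    then have "?u m = ?u m'" by (simp split: if_splits)
    then have "{m..<m + n} = {m'..<m' + n}" by (metis fset_u)
    then show "m = m'" using assms by (simp add: atLeastLessThan_eq_iff)
  qed
  ultimately have "infinite (range ?f)" "range ?f \<subseteq> Ggrp n"
    using range_inj_infinite by blast+
  then show False using fin finite_subset by blast
qed

lemma vsum_update:
  assumes "finite A"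
  shows "vsum (e(j := x)) A = (if j \<in> A then vec x + vsum e (A - {j}) else vsum e A)"
proof (cases "j \<in> A")
  case True
  then have "vsum (e(j := x)) A = vec x + (\<Sum>i\<in>A - {j}. vec ((e(j := x)) i))"
    unfolding vsum_def using assms by (simp add: sum.remove)
  also have "(\<Sum>i\<in>A - {j}. vec ((e(j := x)) i)) = vsum e (A - {j})"
    unfolding vsum_def by (rule sum.cong) auto
  finally show ?thesis using True by (simp only: if_True)
next
  case False
  then have "vsum (e(j := x)) A = vsum e A" unfolding vsum_def by (intro sum.cong) auto
  then show ?thesis using False by (simp only: if_False)
qed

text \<open>
  If the new element is a sum of old ones, the same sum answers it. Otherwise the coordinates below \<open>K\<close>
  are answered independently of one another, which is possible because \<open>G\<^sub>\<omega>\<close> is the full product, and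
  coordinate \<open>K\<close> is used to make the answer differ from all sums of old elements; it is invisible to
  the covering conditions.
\<close>

lemma sim_extend:
  assumes K: "0 < K" and j: "j < N"
  shows "\<exists>l. \<forall>e e' x. (\<forall>i. e i \<in> univ Mstruct) \<longrightarrow> (\<forall>i. e' i \<in> univ Mstruct) \<longrightarrow> sim N K l e e' \<longrightarrow>
    x \<in> univ Mstruct \<longrightarrow> (\<exists>x'\<in>univ Mstruct. sim N K k (e(j := x)) (e'(j := x')))"
proof -
  define I where "I = Pow ({..<N} - {j})"
  have I: "finite I" by (simp add: I_def)
  have "\<forall>n. \<exists>k'. \<forall>(\<sigma> :: nat set \<Rightarrow> nat fset \<Rightarrow> bit) \<sigma>' \<zeta>.
    (\<forall>A\<in>I. \<sigma> A \<in> Ggrp n \<and> \<sigma>' A \<in> Ggrp n) \<longrightarrow> \<zeta> \<in> Ggrp n \<longrightarrow>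
    (\<forall>A\<in>I. \<forall>B\<in>I. \<forall>F. small k' F \<longrightarrow> covers F (\<sigma> A + \<sigma> B) = covers F (\<sigma>' A + \<sigma>' B)) \<longrightarrow>
    (\<exists>\<zeta>'\<in>Ggrp n. \<forall>A\<in>I. \<forall>F. small k F \<longrightarrow> covers F (\<zeta> + \<sigma> A) = covers F (\<zeta>' + \<sigma>' A))"
    using extend_coordinate[OF I] by blast
  then obtain kf where kf: "\<And>n (\<sigma> :: nat set \<Rightarrow> nat fset \<Rightarrow> bit) \<sigma>' \<zeta>.
    (\<forall>A\<in>I. \<sigma> A \<in> Ggrp n \<and> \<sigma>' A \<in> Ggrp n) \<Longrightarrow> \<zeta> \<in> Ggrp n \<Longrightarrow>
    (\<forall>A\<in>I. \<forall>B\<in>I. \<forall>F. small (kf n) F \<longrightarrow> covers F (\<sigma> A + \<sigma> B) = covers F (\<sigma>' A + \<sigma>' B)) \<Longrightarrow>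
    (\<exists>\<zeta>'\<in>Ggrp n. \<forall>A\<in>I. \<forall>F. small k F \<longrightarrow> covers F (\<zeta> + \<sigma> A) = covers F (\<zeta>' + \<sigma>' A))"
    using choice[of "\<lambda>n k'. \<forall>(\<sigma> :: nat set \<Rightarrow> nat fset \<Rightarrow> bit) \<sigma>' \<zeta>.
    (\<forall>A\<in>I. \<sigma> A \<in> Ggrp n \<and> \<sigma>' A \<in> Ggrp n) \<longrightarrow> \<zeta> \<in> Ggrp n \<longrightarrow>
    (\<forall>A\<in>I. \<forall>B\<in>I. \<forall>F. small k' F \<longrightarrow> covers F (\<sigma> A + \<sigma> B) = covers F (\<sigma>' A + \<sigma>' B)) \<longrightarrow>
    (\<exists>\<zeta>'\<in>Ggrp n. \<forall>A\<in>I. \<forall>F. small k F \<longrightarrow> covers F (\<zeta> + \<sigma> A) = covers F (\<zeta>' + \<sigma>' A))"] by blast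
  define l where "l = Max (insert k (kf ` {..<K}))"
  have kl: "k \<le> l" by (simp add: l_def)
  have kfl: "kf n \<le> l" if "n < K" for n using that by (auto simp: l_def)
  have main: "\<exists>x'\<in>univ Mstruct. sim N K k (e(j := x)) (e'(j := x'))"
    if e: "\<And>i. e i \<in> univ Mstruct" and e': "\<And>i. e' i \<in> univ Mstruct"
      and sim: "sim N K l e e'" and x: "x \<in> univ Mstruct" for e e' x
  proof -
    have sort: "\<forall>i<N. \<forall>m. e i = Inr m \<longleftrightarrow> e' i = Inr m" using sim by (simp add: sim_def)
    have vG: "vsum e A \<in> Gomega" "vsum e' A \<in> Gomega" for A
      using e e' by (intro vsum_in_Gomega; blast)+
    have zero: "vsum e A = 0 \<longleftrightarrow> vsum e' A = 0" if "A \<subseteq> {..<N}" for A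
      using sim that by (simp add: sim_def)
    have cov: "covers F (vsum e A n) = covers F (vsum e' A n)"
      if "A \<subseteq> {..<N}" "n < K" "small l F" for A n and F :: "nat fset set"
      using sim that by (simp add: sim_def)
    have IN: "A \<subseteq> {..<N}" "finite A" if "A \<in> I" for A
      using that finite_subset[of A "{..<N}"] by (auto simp: I_def)
    have rem: "A - {j} \<in> I" if "A \<subseteq> {..<N}" for A using that by (auto simp: I_def)
    have finN: "finite A" if "A \<subseteq> {..<N}" for A using that finite_subset by blast
    have sd: "(A - B) \<union> (B - A) \<in> I" if "A \<in> I" "B \<in> I" for A B using that by (auto simp: I_def)
    \<comment> \<open>Sums that do not involve the updated variable were compared before.\<close>
    have suffices: "sim N K k (e(j := x)) (e'(j := x'))"
      if s: "\<forall>m. x = Inr m \<longleftrightarrow> x' = Inr m"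
        and z: "\<And>A. A \<in> I \<Longrightarrow> vec x + vsum e A = 0 \<longleftrightarrow> vec x' + vsum e' A = 0"
        and c: "\<And>A n F. A \<in> I \<Longrightarrow> n < K \<Longrightarrow> small k F \<Longrightarrow>
          covers F ((vec x + vsum e A) n) = covers F ((vec x' + vsum e' A) n)" for x'
      unfolding sim_def
    proof (intro conjI allI impI)
      fix i m assume "i < N"
      then show "(e(j := x)) i = Inr m \<longleftrightarrow> (e'(j := x')) i = Inr m" using sort s by simp
    next
      fix A assume A: "A \<subseteq> {..<N}"
      show "vsum (e(j := x)) A = 0 \<longleftrightarrow> vsum (e'(j := x')) A = 0"
        using z[OF rem[OF A]] zero[OF A] by (simp add: vsum_update finN[OF A])
      fix n and F :: "nat fset set" assume n: "n < K" and F: "small k F"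
      show "covers F (vsum (e(j := x)) A n) = covers F (vsum (e'(j := x')) A n)"
        using c[OF rem[OF A] n F] cov[OF A n small_mono[OF F kl]]
        by (simp add: vsum_update finN[OF A] del: plus_fun_apply)
    qed
    show ?thesis
    proof (cases x)
      case (Inr m)
      have vx: "vec x + f = f" for f unfolding Inr vec_simps by (rule add_0)
      have "sim N K k (e(j := x)) (e'(j := x))"
      proof (rule suffices)
        fix A assume A: "A \<in> I"
        show "vec x + vsum e A = 0 \<longleftrightarrow> vec x + vsum e' A = 0"
          unfolding vx by (rule zero[OF IN(1)[OF A]])
        fix n and F :: "nat fset set" assume "n < K" "small k F"
        then show "covers F ((vec x + vsum e A) n) = covers F ((vec x + vsum e' A) n)"
          unfolding vx using cov[OF IN(1)[OF A]] small_mono[OF _ kl] by blast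
      qed simp
      then show ?thesis using x by blast
    next
      case (Inl \<zeta>)
      then have \<zeta>: "\<zeta> \<in> Gomega" using x by (auto simp: univ_M)
      show ?thesis
      proof (cases "\<exists>B\<in>I. \<zeta> = vsum e B")
        case True
        then obtain B where B: "B \<in> I" "\<zeta> = vsum e B" by blast
        let ?x = "Inl (vsum e' B) :: melem"
        have "sim N K k (e(j := x)) (e'(j := ?x))"
        proof (rule suffices)
          fix A assume A: "A \<in> I"
          note sdA = vsum_sym_diff[OF IN(2)[OF B(1)] IN(2)[OF A]]
          have N: "(B - A) \<union> (A - B) \<subseteq> {..<N}" using sd[OF B(1) A] IN by blast
          show "vec x + vsum e A = 0 \<longleftrightarrow> vec ?x + vsum e' A = 0"
            unfolding Inl B(2) vec_simps sdA by (rule zero[OF N])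
          fix n and F :: "nat fset set" assume "n < K" "small k F"
          then show "covers F ((vec x + vsum e A) n) = covers F ((vec ?x + vsum e' A) n)"
            unfolding Inl B(2) vec_simps sdA using cov[OF N] small_mono[OF _ kl] by blast
        qed (simp add: Inl)
        moreover have "?x \<in> univ Mstruct" using vG unfolding univ_M by blast
        ultimately show ?thesis by blast
      next
        case False
        have vGn: "vsum e A n \<in> Ggrp n" "vsum e' A n \<in> Ggrp n" for A n
          using vG unfolding Gomega_def by blast+
        have "\<exists>\<zeta>'\<in>Ggrp n. \<forall>A\<in>I. \<forall>F. small k F \<longrightarrow>
            covers F (\<zeta> n + vsum e A n) = covers F (\<zeta>' + vsum e' A n)" if n: "n < K" for n
        proof (rule kf)
          show "\<zeta> n \<in> Ggrp n" using \<zeta> by (simp add: Gomega_def)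
          show "\<forall>A\<in>I. \<forall>B\<in>I. \<forall>F. small (kf n) F \<longrightarrow>
            covers F (vsum e A n + vsum e B n) = covers F (vsum e' A n + vsum e' B n)"
          proof (intro ballI allI impI)
            fix A B and F :: "nat fset set" assume A: "A \<in> I" and B: "B \<in> I" and F: "small (kf n) F"
            note sdA = vsum_sym_diff[OF IN(2)[OF A] IN(2)[OF B]]
            have N: "(A - B) \<union> (B - A) \<subseteq> {..<N}" using sd[OF A B] IN by blast
            have "covers F ((vsum e A + vsum e B) n) = covers F ((vsum e' A + vsum e' B) n)"
              unfolding sdA using cov[OF N n small_mono[OF F kfl[OF n]]] .
            then show "covers F (vsum e A n + vsum e B n) = covers F (vsum e' A n + vsum e' B n)"
              by simp
          qed
        qed (use vGn in blast)
        then have "\<forall>n. \<exists>\<zeta>'. n < K \<longrightarrow> \<zeta>' \<in> Ggrp n \<and> (\<forall>A\<in>I. \<forall>F. small k F \<longrightarrow>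
            covers F (\<zeta> n + vsum e A n) = covers F (\<zeta>' + vsum e' A n))" by blast
        from choice[OF this] obtain h where h: "\<And>n. n < K \<Longrightarrow> h n \<in> Ggrp n"
          "\<And>n A F. n < K \<Longrightarrow> A \<in> I \<Longrightarrow> small k F \<Longrightarrow>
            covers F (\<zeta> n + vsum e A n) = covers F (h n + vsum e' A n)" by blast
        \<comment> \<open>The coordinate \<open>c\<close> keeps the answer different from all sums of old elements.\<close>
        have "infinite (Ggrp K - (\<lambda>A. vsum e' A K) ` I)"
          using infinite_Ggrp[OF K] I by simp
        then obtain c where c: "c \<in> Ggrp K" "c \<notin> (\<lambda>A. vsum e' A K) ` I"
          by (metis Diff_iff ex_in_conv finite.emptyI)
        define \<zeta>' where "\<zeta>' n = (if n < K then h n else if n = K then c else 0)" for n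
        have "0 \<in> Ggrp n" for n using zero_in_Gomega by (simp add: Gomega_def)
        then have G: "\<zeta>' \<in> Gomega" using h(1) c(1) by (simp add: Gomega_def \<zeta>'_def)
        have "sim N K k (e(j := x)) (e'(j := Inl \<zeta>'))"
        proof (rule suffices)
          fix A assume A: "A \<in> I"
          have "\<zeta>' K \<noteq> vsum e' A K" using c(2) A by (auto simp: \<zeta>'_def)
          then have "\<zeta>' \<noteq> vsum e' A" by blast
          moreover have "\<zeta> \<noteq> vsum e A" using False A by blast
          ultimately show "vec x + vsum e A = 0 \<longleftrightarrow> vec (Inl \<zeta>') + vsum e' A = 0"
            unfolding Inl vec_simps gomega_add_eq_0_iff by blast
          fix n and F :: "nat fset set" assume "n < K" "small k F"
          moreover have "(vec x + vsum e A) n = \<zeta> n + vsum e A n"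
            unfolding Inl vec_simps by (rule plus_fun_apply)
          moreover have "(vec (Inl \<zeta>') + vsum e' A) n = \<zeta>' n + vsum e' A n"
            unfolding vec_simps by (rule plus_fun_apply)
          moreover have "\<zeta>' n = h n" using \<open>n < K\<close> by (simp add: \<zeta>'_def)
          ultimately show "covers F ((vec x + vsum e A) n) = covers F ((vec (Inl \<zeta>') + vsum e' A) n)"
            using h(2)[OF \<open>n < K\<close> A \<open>small k F\<close>] by (simp only:)
        qed (simp add: Inl)
        moreover have "Inl \<zeta>' \<in> univ Mstruct" using G unfolding univ_M by blast
        ultimately show ?thesis by blast
      qed
    qed
  qed
  show ?thesis
  proof (intro exI[of _ l] allI impI)
    fix e e' :: "nat \<Rightarrow> melem" and x
    assume *: "\<forall>i. e i \<in> univ Mstruct" "\<forall>i. e' i \<in> univ Mstruct" "sim N K l e e'" "x \<in> univ Mstruct"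
    show "\<exists>x'\<in>univ Mstruct. sim N K k (e(j := x)) (e'(j := x'))"
      by (rule main[OF *(1)[rule_format] *(2)[rule_format] *(3,4)])
  qed
qed

lemma sat_sim:
  assumes "bounded_by N K \<phi>" "0 < K"
  shows "\<exists>k\<ge>1. \<forall>e e'. (\<forall>i. e i \<in> univ Mstruct) \<longrightarrow> (\<forall>i. e' i \<in> univ Mstruct) \<longrightarrow> sim N K k e e' \<longrightarrow>
    (sat Mstruct e \<phi> \<longleftrightarrow> sat Mstruct e' \<phi>)"
  using assms(1)
proof (induction \<phi>)
  case (Eq s t)
  then show ?case using sat_atomic_sim(1) by (intro exI[of _ 1]) fastforce
next
  case (PredP t)
  then show ?case using sat_atomic_sim(2) by (intro exI[of _ 1]) fastforce
next
  case (PredQ t)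
  then show ?case using sat_atomic_sim(3) by (intro exI[of _ 1]) fastforce
next
  case (RelR n s t)
  then show ?case using sat_atomic_sim(4) by (intro exI[of _ 1]) fastforce
next
  case (Neg \<phi>)
  then show ?case by simp
next
  case (Conj \<phi> \<psi>)
  then obtain k l where kl: "k \<ge> 1"
    "\<forall>e e'. (\<forall>i. e i \<in> univ Mstruct) \<longrightarrow> (\<forall>i. e' i \<in> univ Mstruct) \<longrightarrow> sim N K k e e' \<longrightarrow>
      (sat Mstruct e \<phi> \<longleftrightarrow> sat Mstruct e' \<phi>)"
    "\<forall>e e'. (\<forall>i. e i \<in> univ Mstruct) \<longrightarrow> (\<forall>i. e' i \<in> univ Mstruct) \<longrightarrow> sim N K l e e' \<longrightarrow>
      (sat Mstruct e \<psi> \<longleftrightarrow> sat Mstruct e' \<psi>)" by auto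
  have "sim N K k e e' \<and> sim N K l e e'" if "sim N K (k + l) e e'" for e e'
    using that sim_antimono by (meson le_add1 le_add2)
  then show ?case using kl by (intro exI[of _ "k + l"]) simp
next
  case (Ex j \<phi>)
  then obtain k where k: "k \<ge> 1"
    "\<And>e e'. (\<forall>i. e i \<in> univ Mstruct) \<Longrightarrow> (\<forall>i. e' i \<in> univ Mstruct) \<Longrightarrow> sim N K k e e' \<Longrightarrow>
      (sat Mstruct e \<phi> \<longleftrightarrow> sat Mstruct e' \<phi>)" by auto
  have j: "j < N" using Ex.prems by simp
  obtain l where l: "\<And>e e' x. (\<forall>i. e i \<in> univ Mstruct) \<Longrightarrow> (\<forall>i. e' i \<in> univ Mstruct) \<Longrightarrow> sim N K l e e' \<Longrightarrow>
    x \<in> univ Mstruct \<Longrightarrow> (\<exists>x'\<in>univ Mstruct. sim N K k (e(j := x)) (e'(j := x')))"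
    using sim_extend[OF assms(2) j, of k] by blast
  have one: "sat Mstruct e' (Ex j \<phi>)"
    if e: "\<forall>i. e i \<in> univ Mstruct" "\<forall>i. e' i \<in> univ Mstruct" "sim N K l e e'" "sat Mstruct e (Ex j \<phi>)" for e e'
  proof -
    obtain x where x: "x \<in> univ Mstruct" "sat Mstruct (e(j := x)) \<phi>" using e(4) by auto
    then obtain x' where x': "x' \<in> univ Mstruct" "sim N K k (e(j := x)) (e'(j := x'))" using l e by blast
    have "sat Mstruct (e'(j := x')) \<phi>" using k(2)[of "e(j := x)" "e'(j := x')"] e x x' by simp
    then show ?thesis using x'(1) by auto
  qed
  have "sat Mstruct e (Ex j \<phi>) \<longleftrightarrow> sat Mstruct e' (Ex j \<phi>)"
    if "\<forall>i. e i \<in> univ Mstruct" "\<forall>i. e' i \<in> univ Mstruct" "sim N K (max 1 l) e e'" for e e'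
  proof -
    have "sim N K l e e'" using that(3) by (rule sim_antimono) simp
    then show ?thesis using one that(1,2) sim_sym by blast
  qed
  then show ?case by (intro exI[of _ "max 1 l"]) simp
qed

section \<open>Automorphisms from permutations of \<open>\<omega>\<close>\<close>

text \<open>
  Precomposition with \<open>g\<close> is the action of the inverse of \<open>g\<close>; for involutions this is the action
  of \<open>g\<close> itself.
\<close>

definition act_vec :: "(nat \<Rightarrow> nat) \<Rightarrow> (nat \<Rightarrow> nat fset \<Rightarrow> bit) \<Rightarrow> nat \<Rightarrow> nat fset \<Rightarrow> bit" where
  "act_vec g \<eta> = (\<lambda>n u. \<eta> n (g |`| u))"

fun act :: "(nat \<Rightarrow> nat) \<Rightarrow> melem \<Rightarrow> melem" where
  "act g (Inl \<eta>) = Inl (act_vec g \<eta>)"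
| "act g (Inr m) = Inr (g m)"

lemma fimage_involution: "g \<circ> g = id \<Longrightarrow> g |`| g |`| u = u"
  by (metis fset.map_comp fset.map_id)

lemma fcard_fimage_involution:
  assumes "g \<circ> g = id"
  shows "fcard (g |`| u) = fcard u"
proof -
  have "inj g" using assms by (metis comp_apply id_apply injI)
  then show ?thesis by (simp add: fcard.rep_eq card_image inj_on_subset)
qed

lemma act_involution:
  assumes "g \<circ> g = id"
  shows "act g (act g x) = x"
proof -
  have "g (g m) = m" for m using assms by (metis comp_apply id_apply)
  then show ?thesis
    by (cases x) (simp_all add: act_vec_def assms fset.map_id)
qed

lemma act_vec_in_Gomega:
  assumes g: "g \<circ> g = id" and "\<eta> \<in> Gomega"
  shows "act_vec g \<eta> \<in> Gomega"
proof -
  have "act_vec g \<eta> n \<in> Ggrp n" for n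
  proof -
    have G: "\<eta> n \<in> Ggrp n" using assms(2) by (simp add: Gomega_def)
    have "supp (act_vec g \<eta> n) \<subseteq> (\<lambda>u. g |`| u) ` supp (\<eta> n)"
    proof
      fix u assume "u \<in> supp (act_vec g \<eta> n)"
      then have "g |`| u \<in> supp (\<eta> n)" by (simp add: supp_def act_vec_def)
      then show "u \<in> (\<lambda>u. g |`| u) ` supp (\<eta> n)"
        using fimage_involution[OF g, of u] by (intro image_eqI[of _ _ "g |`| u"]) simp_all
    qed
    then have "finite (supp (act_vec g \<eta> n))" using finite_supp[OF G] finite_subset by blast
    moreover have "fcard u = n" if "u \<in> supp (act_vec g \<eta> n)" for u
    proof -
      have "\<eta> n (g |`| u) \<noteq> 0" using that by (simp add: supp_def act_vec_def)
      then have "fcard (g |`| u) = n" by (rule Ggrp_fcard[OF G])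
      then show ?thesis by (simp add: fcard_fimage_involution[OF g])
    qed
    ultimately show ?thesis by (simp add: Ggrp_def Vgrp_def)
  qed
  then show ?thesis by (simp add: Gomega_def)
qed

lemma act_univ: "g \<circ> g = id \<Longrightarrow> x \<in> univ Mstruct \<Longrightarrow> act g x \<in> univ Mstruct"
  by (cases x) (auto simp: univ_M act_vec_in_Gomega)

lemma act_vec_add: "act_vec g (\<eta> + \<theta>) = act_vec g \<eta> + act_vec g \<theta>"
  unfolding act_vec_def plus_fun_def by (rule refl)

lemma act_vec_0: "act_vec g 0 = 0"
  unfolding act_vec_def zero_fun_def by (rule refl)

lemma tval_act: "tval Mstruct (act g \<circ> e) t = act g (tval Mstruct e t)"
proof (induction t)
  case (Plus s t)
  then show ?case
    by (cases "tval Mstruct e s"; cases "tval Mstruct e t")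
       (simp_all only: tval.simps Mstruct_def lstruct.simps Mplus.simps act.simps act_vec_add act_vec_0)
qed (simp_all only: tval.simps comp_apply Mstruct_def lstruct.simps act.simps act_vec_0)

lemma covers_act:
  assumes g: "g \<circ> g = id"
  shows "covers ((\<lambda>s. g |`| s) ` F) (act_vec g \<eta> n) \<longleftrightarrow> covers F (\<eta> n)"
proof -
  have sub: "g |`| s |\<subseteq>| u \<longleftrightarrow> s |\<subseteq>| g |`| u" for s u
    by (metis fimage_involution[OF g] fimage_mono)
  have "covers ((\<lambda>s. g |`| s) ` F) (act_vec g \<eta> n) \<longleftrightarrow>
      (\<forall>u. \<eta> n (g |`| u) \<noteq> 0 \<longrightarrow> (\<exists>s\<in>F. s |\<subseteq>| g |`| u))"
    unfolding covers_def act_vec_def by (simp add: sub)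
  also have "\<dots> \<longleftrightarrow> covers F (\<eta> n)" unfolding covers_def by (metis fimage_involution[OF g])
  finally show ?thesis .
qed

lemma intR_act:
  assumes g: "g \<circ> g = id"
  shows "(act g x, act g y) \<in> intR Mstruct n \<longleftrightarrow> (x, y) \<in> intR Mstruct n"
proof -
  have imp: "(act g x, act g y) \<in> intR Mstruct n" if "(x, y) \<in> intR Mstruct n" for x y
  proof -
    obtain \<eta> m where xy: "x = Inl \<eta>" "y = Inr m" using intR_M_sorts \<open>(x, y) \<in> _\<close> by blast
    then have "\<eta> \<in> Gomega" "covers {{|m|}} (\<eta> n)" using that intR_M by blast+
    then show ?thesis
      using covers_act[OF g, of "{{|m|}}" \<eta> n] act_vec_in_Gomega[OF g] by (simp add: xy intR_M)
  qed
  show ?thesis using imp[of x y] imp[of "act g x" "act g y"] act_involution[OF g] by auto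
qed

lemma act_sorts:
  assumes g: "g \<circ> g = id"
  shows "act g x \<in> intP Mstruct \<longleftrightarrow> x \<in> intP Mstruct"
    and "act g x \<in> intQ Mstruct \<longleftrightarrow> x \<in> intQ Mstruct"
proof -
  have "act g x \<in> intP Mstruct" if "x \<in> intP Mstruct" for x
    using that act_vec_in_Gomega[OF g] by (auto simp: Mstruct_def)
  from this[of x] this[of "act g x"] show "act g x \<in> intP Mstruct \<longleftrightarrow> x \<in> intP Mstruct"
    using act_involution[OF g] by auto
  show "act g x \<in> intQ Mstruct \<longleftrightarrow> x \<in> intQ Mstruct"
    by (cases x) (auto simp: Mstruct_def)
qed

lemma sat_act:
  assumes g: "g \<circ> g = id"
  shows "sat Mstruct (act g \<circ> e) \<phi> \<longleftrightarrow> sat Mstruct e \<phi>"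
proof (induction \<phi> arbitrary: e)
  case (Eq s t)
  then show ?case by (simp only: sat.simps tval_act) (metis act_involution[OF g])
next
  case (Ex j \<phi>)
  have upd: "(act g \<circ> e)(j := act g x) = act g \<circ> (e(j := x))" for x by auto
  have "sat Mstruct (act g \<circ> e) (Ex j \<phi>) \<longleftrightarrow> (\<exists>x\<in>univ Mstruct. sat Mstruct ((act g \<circ> e)(j := act g x)) \<phi>)"
    by (simp only: sat.simps) (metis act_involution[OF g] act_univ[OF g])
  then show ?case by (simp only: upd Ex sat.simps)
qed (simp_all only: sat.simps tval_act act_sorts[OF g] intR_act[OF g])

section \<open>From a model of the theory to finite chains in the structure\<close>

fun rename_trm :: "(nat \<Rightarrow> nat) \<Rightarrow> ltrm \<Rightarrow> ltrm" where
  "rename_trm r (Var k) = Var (r k)"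
| "rename_trm r Zero = Zero"
| "rename_trm r (Plus s t) = Plus (rename_trm r s) (rename_trm r t)"

text \<open>
  Bound variables are renamed together with the free ones. For injective \<open>r\<close> no capture can occur.
\<close>

fun rename :: "(nat \<Rightarrow> nat) \<Rightarrow> lfm \<Rightarrow> lfm" where
  "rename r (Eq s t) = Eq (rename_trm r s) (rename_trm r t)"
| "rename r (PredP t) = PredP (rename_trm r t)"
| "rename r (PredQ t) = PredQ (rename_trm r t)"
| "rename r (RelR n s t) = RelR n (rename_trm r s) (rename_trm r t)"
| "rename r (Neg \<phi>) = Neg (rename r \<phi>)"
| "rename r (Conj \<phi> \<psi>) = Conj (rename r \<phi>) (rename r \<psi>)"
| "rename r (Ex k \<phi>) = Ex (r k) (rename r \<phi>)"

lemma tval_rename: "tval N e (rename_trm r t) = tval N (e \<circ> r) t"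
  by (induction t) auto

lemma sat_rename: "inj r \<Longrightarrow> sat N e (rename r \<phi>) \<longleftrightarrow> sat N (e \<circ> r) \<phi>"
proof (induction \<phi> arbitrary: e)
  case (Ex k \<phi>)
  have "(e(r k := x)) \<circ> r = (e \<circ> r)(k := x)" for x
    using Ex.prems by (auto simp: inj_def)
  then show ?case by (simp only: rename.simps sat.simps Ex.IH[OF Ex.prems])
qed (simp_all add: tval_rename)

lemma tval_cong: "(\<And>k. k \<in> tvars t \<Longrightarrow> e k = e' k) \<Longrightarrow> tval N e t = tval N e' t"
  by (induction t) auto

lemma sat_cong: "(\<And>k. k \<in> fvars \<phi> \<Longrightarrow> e k = e' k) \<Longrightarrow> sat N e \<phi> \<longleftrightarrow> sat N e' \<phi>"
proof (induction \<phi> arbitrary: e e')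
  case (Eq s t)
  then have "tval N e s = tval N e' s" "tval N e t = tval N e' t" by (auto intro!: tval_cong)
  then show ?case by simp
next
  case (PredP t)
  then have "tval N e t = tval N e' t" by (auto intro!: tval_cong)
  then show ?case by simp
next
  case (PredQ t)
  then have "tval N e t = tval N e' t" by (auto intro!: tval_cong)
  then show ?case by simp
next
  case (RelR n s t)
  then have "tval N e s = tval N e' s" "tval N e t = tval N e' t" by (auto intro!: tval_cong)
  then show ?case by simp
next
  case (Neg \<phi>)
  have "sat N e \<phi> = sat N e' \<phi>" using Neg.prems by (intro Neg.IH) simp
  then show ?case by simp
next
  case (Conj \<phi> \<psi>)
  have "sat N e \<phi> = sat N e' \<phi>" using Conj.prems by (intro Conj.IH(1)) simp
  moreover have "sat N e \<psi> = sat N e' \<psi>" using Conj.prems by (intro Conj.IH(2)) simp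
  ultimately show ?case by simp
next
  case (Ex k \<phi>)
  have "sat N (e(k := x)) \<phi> = sat N (e'(k := x)) \<phi>" for x
    using Ex.prems by (intro Ex.IH) simp
  then show ?case by simp
qed

fun conjs :: "lfm list \<Rightarrow> lfm" where
  "conjs [] = Eq Zero Zero"
| "conjs (\<phi> # \<phi>s) = Conj \<phi> (conjs \<phi>s)"

lemma sat_conjs: "sat N e (conjs \<phi>s) \<longleftrightarrow> (\<forall>\<phi>\<in>set \<phi>s. sat N e \<phi>)"
  by (induction \<phi>s) auto

fun exs :: "nat list \<Rightarrow> lfm \<Rightarrow> lfm" where
  "exs [] \<phi> = \<phi>"
| "exs (k # ks) \<phi> = Ex k (exs ks \<phi>)"

lemma fvars_exs: "fvars (exs ks \<phi>) = fvars \<phi> - set ks"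
  by (induction ks) auto

lemma sat_exsI: "sat N e \<phi> \<Longrightarrow> (\<forall>k. e k \<in> univ N) \<Longrightarrow> sat N e (exs ks \<phi>)"
proof (induction ks)
  case (Cons k ks)
  then have "sat N (e(k := e k)) (exs ks \<phi>)" by simp
  then show ?case using Cons.prems(2) by (simp only: exs.simps sat.simps) blast
qed simp

lemma sat_exsE:
  "sat N e (exs ks \<phi>) \<Longrightarrow> (\<forall>k. e k \<in> univ N) \<Longrightarrow> \<exists>e'. (\<forall>k. e' k \<in> univ N) \<and> sat N e' \<phi>"
proof (induction ks arbitrary: e)
  case Nil
  then show ?case by auto
next
  case (Cons k ks)
  then obtain x where x: "x \<in> univ N" "sat N (e(k := x)) (exs ks \<phi>)" by auto
  have "\<forall>l. (e(k := x)) l \<in> univ N" using x(1) Cons.prems(2) by simp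
  then show ?case by (rule Cons.IH[OF x(2)])
qed

text \<open>
  The existential closure of \<open>\<phi>\<close> is a sentence; if it failed in \<open>M\<close>, its negation would belong to the
  theory.
\<close>

lemma satisfiable_transfer:
  assumes N: "is_model N (Th M)" and M: "is_lstruct M"
    and sat: "sat N e \<phi>" and e: "\<forall>k. e k \<in> univ N"
  shows "\<exists>e'. (\<forall>k. e' k \<in> univ M) \<and> sat M e' \<phi>"
proof (rule ccontr)
  assume no: "\<not> ?thesis"
  obtain ks where ks: "set ks = fvars \<phi>" using finite_list[OF finite_fvars] by blast
  have "sat M e' (Neg (exs ks \<phi>))" if "range e' \<subseteq> univ M" for e'
  proof -
    have "\<forall>k. e' k \<in> univ M" using that by auto
    then have "\<not> sat M e' (exs ks \<phi>)" using no sat_exsE[of M e' ks \<phi>] by blast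
    then show ?thesis by simp
  qed
  then have "Neg (exs ks \<phi>) \<in> Th M" by (auto simp: Th_def true_in_def fvars_exs ks)
  then have "true_in N (Neg (exs ks \<phi>))" using N by (simp add: is_model_def)
  moreover have "range e \<subseteq> univ N" using e by blast
  ultimately have "sat N e (Neg (exs ks \<phi>))" unfolding true_in_def by blast
  then show False using sat_exsI[OF sat e, of ks] by simp
qed

text \<open>
  A chain of length \<open>L\<close> is described by the conjunction of \<open>L * L\<close> renamed copies of \<open>\<phi>\<close> or its negation,
  whose satisfiability transfers.
\<close>

lemma finite_chains_in_M:
  fixes N :: "'c lstruct"
  assumes N: "is_model N (Th Mstruct)" and ord: "order_property N p q \<phi>"
  shows "\<exists>a b. (\<forall>i k. a i k \<in> univ Mstruct) \<and> (\<forall>j k. b j k \<in> univ Mstruct) \<and>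
    (\<forall>i<L. \<forall>j<L. sat Mstruct (\<lambda>k. if k < p then a i k else b j k) \<phi> \<longleftrightarrow> i < (j::nat))"
proof -
  have fv: "fvars \<phi> \<subseteq> {..<p + q}" using ord by (simp add: order_property_def)
  define P where "P a b \<longleftrightarrow> (\<forall>i. length (a i) = p \<and> set (a i) \<subseteq> univ N) \<and>
    (\<forall>j. length (b j) = q \<and> set (b j) \<subseteq> univ N) \<and>
    (\<forall>i j. sat N (\<lambda>k. (a i @ b j) ! k) \<phi> \<longleftrightarrow> i < j)" for a b :: "nat \<Rightarrow> 'c list"
  have "\<exists>a b. P a b" using ord unfolding order_property_def P_def by (rule conjunct2)
  then obtain a b where "P a b" by blast
  then have a: "length (a i) = p \<and> set (a i) \<subseteq> univ N"
    and b: "length (b j) = q \<and> set (b j) \<subseteq> univ N"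
    and ab: "sat N (\<lambda>k. (a i @ b j) ! k) \<phi> \<longleftrightarrow> i < j" for i j
    by (simp_all add: P_def)
  \<comment> \<open>Odd first components code the variables for \<open>a\<^sub>i\<close>, even positive ones those for \<open>b\<^sub>j\<close>, and \<open>0\<close>
    the bound variables. Keeping \<open>k\<close> as second component makes \<open>r i j\<close> injective.\<close>
  define r where "r i j k = prod_encode (if k < p then 2 * i + 1 else if k < p + q then 2 * j + 2 else 0, k)"
    for i j k :: nat
  have inj: "inj (r i j)" for i j by (rule injI) (simp add: r_def)
  define \<psi> where "\<psi> i j = (if i < j then rename (r i j) \<phi> else Neg (rename (r i j) \<phi>))" for i j
  define \<chi> where "\<chi> = conjs (concat (map (\<lambda>i. map (\<psi> i) [0..<L]) [0..<L]))"
  have \<psi>: "sat M e (\<psi> i j) \<longleftrightarrow> (sat M (e \<circ> r i j) \<phi> \<longleftrightarrow> i < j)" for M :: "'d lstruct" and e i j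
    by (simp add: \<psi>_def sat_rename[OF inj])
  have \<chi>: "sat M e \<chi> \<longleftrightarrow> (\<forall>i<L. \<forall>j<L. sat M (e \<circ> r i j) \<phi> \<longleftrightarrow> i < j)" for M :: "'d lstruct" and e
  proof -
    have "sat M e \<chi> \<longleftrightarrow> (\<forall>i<L. \<forall>j<L. sat M e (\<psi> i j))"
      unfolding \<chi>_def sat_conjs by auto
    then show ?thesis by (simp only: \<psi>)
  qed
  define e where "e v = (case prod_decode v of (t, k) \<Rightarrow>
      if t \<noteq> 0 \<and> odd t \<and> k < p then a (t div 2) ! k
      else if t \<noteq> 0 \<and> even t \<and> p \<le> k \<and> k < p + q then b (t div 2 - 1) ! (k - p)
      else int0 N)" for v
  have "int0 N \<in> univ N" using N by (simp add: is_model_def is_lstruct_def)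
  moreover have "a i ! k \<in> univ N" if "k < p" for i k using a[of i] that nth_mem by blast
  moreover have "b j ! (k - p) \<in> univ N" if "p \<le> k" "k < p + q" for j k
  proof -
    have "k - p < length (b j)" using b[of j] that by simp
    then show ?thesis using b[of j] nth_mem by blast
  qed
  ultimately have e: "\<forall>v. e v \<in> univ N" by (simp add: e_def split: prod.split)
  have "sat N (e \<circ> r i j) \<phi> \<longleftrightarrow> i < j" for i j
  proof -
    have "(e \<circ> r i j) k = (a i @ b j) ! k" if "k \<in> fvars \<phi>" for k
      using that fv a[of i] by (auto simp: e_def r_def nth_append)
    then show ?thesis using sat_cong[of \<phi> "e \<circ> r i j" "\<lambda>k. (a i @ b j) ! k" N] ab by blast
  qed
  then have "sat N e \<chi>" by (simp add: \<chi>)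
  from satisfiable_transfer[OF N is_lstruct_Mstruct this e]
  obtain e' where e': "\<forall>k. e' k \<in> univ Mstruct" "sat Mstruct e' \<chi>" by blast
  define a' where "a' i k = e' (prod_encode (2 * i + 1, k))" for i k
  define b' where "b' j k = e' (prod_encode (if k < p + q then 2 * j + 2 else 0, k))" for j k
  have "(\<lambda>k. if k < p then a' i k else b' j k) = e' \<circ> r i j" for i j
    by (auto simp: a'_def b'_def r_def)
  then have "\<forall>i<L. \<forall>j<L. sat Mstruct (\<lambda>k. if k < p then a' i k else b' j k) \<phi> \<longleftrightarrow> i < j"
    using e'(2) by (simp add: \<chi>)
  moreover have "\<forall>i k. a' i k \<in> univ Mstruct" "\<forall>j k. b' j k \<in> univ Mstruct"
    using e'(1) by (simp_all add: a'_def b'_def)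
  ultimately show ?thesis by (intro exI[of _ a'] exI[of _ b'] conjI)
qed

section \<open>Ramsey arguments\<close>

lemma finite_colour_ramsey:
  fixes C :: "'c set"
  assumes C: "finite C"
  shows "\<exists>N. \<forall>f. (\<forall>X\<in>nsets {..<N::nat} r. f X \<in> C) \<longrightarrow>
    (\<exists>H\<subseteq>{..<N}. card H = m \<and> (\<exists>c. \<forall>X\<in>nsets H r. f X = c))"
proof -
  obtain h where h: "bij_betw h C {0..<card C}" using ex_bij_betw_finite_nat[OF C] by blast
  obtain N :: nat where N: "partn_lst {..<N} (replicate (card C) m) r" using ramsey_full by blast
  have "\<exists>H\<subseteq>{..<N}. card H = m \<and> (\<exists>c. \<forall>X\<in>nsets H r. f X = c)"
    if f: "\<forall>X\<in>nsets {..<N} r. f X \<in> C" for f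
  proof -
    have hC: "h c < card C" if "c \<in> C" for c using h that by (auto simp: bij_betw_def)
    have "h \<circ> f \<in> nsets {..<N} r \<rightarrow> {..<length (replicate (card C) m)}"
      using f hC by auto
    then obtain i where i: "i < card C" "monochromatic {..<N} m r (h \<circ> f) i"
      using N unfolding partn_lst_def by auto
    then obtain H where H: "H \<in> nsets {..<N} m" "(h \<circ> f) ` nsets H r \<subseteq> {i}"
      unfolding monochromatic_def by blast
    have sub: "nsets H r \<subseteq> nsets {..<N} r" using H(1) by (intro nsets_mono) (auto simp: nsets_def)
    have "f X = inv_into C h i" if X: "X \<in> nsets H r" for X
    proof -
      have "f X \<in> C" using f sub X by blast
      moreover have "h (f X) = i" using H(2) X by auto
      moreover have "inj_on h C" using h by (simp add: bij_betw_def)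
      ultimately show ?thesis by (metis inv_into_f_f)
    qed
    then show ?thesis using H(1) by (intro exI[of _ H]) (auto simp: nsets_def)
  qed
  then show ?thesis by blast
qed

lemma increasing_enumeration:
  fixes H :: "nat set"
  assumes "finite H"
  shows "\<exists>f. (\<forall>i j. i < j \<longrightarrow> j < card H \<longrightarrow> f i < f j) \<and> f ` {..<card H} = H"
proof (intro exI[of _ "\<lambda>i. sorted_list_of_set H ! i"] conjI allI impI)
  fix i j assume "i < j" "j < card H"
  then show "sorted_list_of_set H ! i < sorted_list_of_set H ! j"
    using assms by (intro sorted_wrt_nth_less[of "(<)"]) simp_all
next
  have "(!) (sorted_list_of_set H) ` {..<length (sorted_list_of_set H)} = set (sorted_list_of_set H)"
    by (auto simp: set_conv_nth)
  then show "(!) (sorted_list_of_set H) ` {..<card H} = H" using assms by simp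
qed

text \<open>
  Sets of at most \<open>M\<close> elements cannot keep violating \<open>A b \<inter> A T \<subseteq> A a\<close>: the traces \<open>A t \<inter> A T\<close> are
  subsets of the fixed set \<open>A T\<close>, so two of them coincide.
\<close>

lemma small_chain_repeats:
  fixes T :: nat
  assumes A: "\<And>t. t \<le> T \<Longrightarrow> small M (A t)" and T: "2 ^ M < T"
  shows "\<exists>a b. a < b \<and> b < T \<and> A b \<inter> A T \<subseteq> A a"
proof -
  have fin: "finite (A T)" "card (A T) \<le> M" using A[OF order_refl] by (simp_all add: small_def)
  have "(\<lambda>t. A t \<inter> A T) ` {..<T} \<subseteq> Pow (A T)" by blast
  then have "card ((\<lambda>t. A t \<inter> A T) ` {..<T}) \<le> card (Pow (A T))"
    using fin by (intro card_mono) auto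
  also have "\<dots> \<le> 2 ^ M" using fin by (simp add: card_Pow)
  finally have "\<not> inj_on (\<lambda>t. A t \<inter> A T) {..<T}" using T by (intro pigeonhole) simp
  then obtain a b where ab: "a < T" "b < T" "a \<noteq> b" "A a \<inter> A T = A b \<inter> A T"
    unfolding inj_on_def by blast
  then show ?thesis by (cases "a < b") (metis inf_le1 linorder_neqE_nat)+
qed

text \<open>
  Above the diagonal, whatever is common to two entries further away from the diagonal in the same row,
  in the same column, or in nested position also belongs to the entry nearer to the diagonal.
\<close>

definition outer_in_inner :: "nat \<Rightarrow> (nat \<Rightarrow> nat \<Rightarrow> 'a set) \<Rightarrow> bool" where
  "outer_in_inner m D \<longleftrightarrow> (\<forall>h' h i j l l'. h' < h \<longrightarrow> h < i \<longrightarrow> i < j \<longrightarrow> j < l \<longrightarrow> l < l' \<longrightarrow> l' < m \<longrightarrow>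
     D i l \<inter> D i l' \<subseteq> D i j \<and> D h j \<inter> D h' j \<subseteq> D i j \<and> D h l \<inter> D h' l' \<subseteq> D i j)"

lemma sorted_list_of_set_6:
  assumes "a < b" "b < c" "c < d" "d < e" "e < (f :: nat)"
  shows "sorted_list_of_set {a, b, c, d, e, f} = [a, b, c, d, e, f]"
proof -
  have "sorted_list_of_set (set [a, b, c, d, e, f]) = [a, b, c, d, e, f]"
    using assms by (intro sorted_list_of_set.idem_if_sorted_distinct) auto
  then show ?thesis by simp
qed

text \<open>
  Colour a six-element set of indices by the list of inclusions that fail for it. On a homogeneous set
  an inclusion that fails once fails always, which \<open>small_chain_repeats\<close> rules out along a row, along
  a column, or along nested entries. So on a homogeneous set nothing fails. The colouring \<open>c\<close> of pairs
  is made constant at the same time; the last four indices are lost because a pair is coloured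
  through a six-element set that starts with it.
\<close>

lemma ramsey_outer_in_inner:
  assumes L: "finite (L :: 'l set)" and C: "finite (C :: 'c set)"
  shows "\<exists>N. \<forall>(D :: 'l \<Rightarrow> nat \<Rightarrow> nat \<Rightarrow> 'a set) c.
    (\<forall>x\<in>L. \<forall>i j. small M (D x i j)) \<longrightarrow> (\<forall>i j. c i j \<in> C) \<longrightarrow>
    (\<exists>f. (\<forall>i j. i < j \<longrightarrow> j < m \<longrightarrow> f i < f j) \<and> (\<forall>i<m. f i < N) \<and>
      (\<forall>x\<in>L. outer_in_inner m (\<lambda>i j. D x (f i) (f j))) \<and>
      (\<exists>c0. \<forall>i j. i < j \<longrightarrow> j + 4 < m \<longrightarrow> c (f i) (f j) = c0))"
proof -
  define T where "T = Suc (2 ^ M)"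
  define m' where "m' = m + 2 * T + 10"
  have "finite (Pow (L \<times> {..<3::nat}) \<times> C)" using L C by simp
  from finite_colour_ramsey[OF this, of 6 m'] obtain N :: nat where
    N: "\<forall>col. (\<forall>X\<in>nsets {..<N} 6. col X \<in> Pow (L \<times> {..<3::nat}) \<times> C) \<longrightarrow>
      (\<exists>H\<subseteq>{..<N}. card H = m' \<and> (\<exists>c. \<forall>X\<in>nsets H 6. col X = c))" by blast
  have "\<exists>f. (\<forall>i j. i < j \<longrightarrow> j < m \<longrightarrow> f i < f j) \<and> (\<forall>i<m. f i < N) \<and>
      (\<forall>x\<in>L. outer_in_inner m (\<lambda>i j. D x (f i) (f j))) \<and>
      (\<exists>c0. \<forall>i j. i < j \<longrightarrow> j + 4 < m \<longrightarrow> c (f i) (f j) = c0)"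
    if D: "\<forall>x\<in>L. \<forall>i j. small M (D x i j)" and c: "\<forall>i j. c i j \<in> C"
    for D :: "'l \<Rightarrow> nat \<Rightarrow> nat \<Rightarrow> 'a set" and c
  proof -
    define bad where "bad x t h' h i j l l' \<longleftrightarrow>
        (t = 0 \<and> \<not> D x i l \<inter> D x i l' \<subseteq> D x i j) \<or>
        (t = 1 \<and> \<not> D x h j \<inter> D x h' j \<subseteq> D x i j) \<or>
        (t = 2 \<and> \<not> D x h l \<inter> D x h' l' \<subseteq> D x i j)" for x and t h' h i j l l' :: nat
    define col where "col X = (let xs = sorted_list_of_set X in
        ({(x, t) \<in> L \<times> {..<3}. bad x t (xs ! 0) (xs ! 1) (xs ! 2) (xs ! 3) (xs ! 4) (xs ! 5)},
         c (xs ! 0) (xs ! 1)))" for X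
    have "\<forall>X\<in>nsets {..<N} 6. col X \<in> Pow (L \<times> {..<3::nat}) \<times> C"
      using c by (auto simp: col_def Let_def)
    from N[THEN spec, THEN mp, OF this]
    obtain H S c0 where H: "H \<subseteq> {..<N}" "card H = m'" "\<And>X. X \<in> nsets H 6 \<Longrightarrow> col X = (S, c0)"
      by (metis surj_pair)
    have finH: "finite H" using H(1) finite_subset by blast
    obtain f where f: "\<And>i j. i < j \<Longrightarrow> j < m' \<Longrightarrow> f i < f j" "f ` {..<m'} = H"
      using increasing_enumeration[OF finH] H(2) by blast
    have col: "{(x, t) \<in> L \<times> {..<3}. bad x t (f h') (f h) (f i) (f j) (f l) (f l')} = S"
      "c (f h') (f h) = c0"
      if "h' < h" "h < i" "i < j" "j < l" "l < l'" "l' < m'" for h' h i j l l'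
    proof -
      have lt: "f h' < f h" "f h < f i" "f i < f j" "f j < f l" "f l < f l'"
        using f(1) that by simp_all
      have "{f h', f h, f i, f j, f l, f l'} \<subseteq> H" using f(2) that by auto
      moreover have "card {f h', f h, f i, f j, f l, f l'} = 6" using lt by simp
      ultimately have "{f h', f h, f i, f j, f l, f l'} \<in> nsets H 6" by (simp add: nsets_def)
      from H(3)[OF this] show "{(x, t) \<in> L \<times> {..<3}. bad x t (f h') (f h) (f i) (f j) (f l) (f l')} = S"
        "c (f h') (f h) = c0"
        using sorted_list_of_set_6[OF lt] by (simp_all add: col_def Let_def)
    qed
    have empty: "S = {}"
    proof (rule ccontr)
      assume "S \<noteq> {}"
      then obtain x t where xt: "(x, t) \<in> S" by auto
      have bad: "x \<in> L \<and> t < 3 \<and> bad x t (f h') (f h) (f i) (f j) (f l) (f l')"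
        if "h' < h" "h < i" "i < j" "j < l" "l < l'" "l' < m'" for h' h i j l l'
        using col(1)[OF that] xt by auto
      have x: "x \<in> L" and t: "t = 0 \<or> t = 1 \<or> t = 2" using bad[of 0 1 2 3 4 5] by (auto simp: m'_def)
      have sm: "small M (D x i j)" for i j using D x by blast
      have T: "2 ^ M < T" by (simp add: T_def)
      from t show False
      proof (elim disjE)
        assume t0: "t = 0"
        obtain a b where ab: "a < b" "b < T"
          "D x (f 2) (f (3 + b)) \<inter> D x (f 2) (f (3 + T)) \<subseteq> D x (f 2) (f (3 + a))"
          using small_chain_repeats[of T M "\<lambda>t. D x (f 2) (f (3 + t))", OF sm T] by blast
        then show False using bad[of 0 1 2 "3 + a" "3 + b" "3 + T"] by (simp add: bad_def t0 m'_def)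
      next
        assume t1: "t = 1"
        obtain a b where ab: "a < b" "b < T"
          "D x (f (T - b)) (f (T + 1)) \<inter> D x (f (T - T)) (f (T + 1)) \<subseteq> D x (f (T - a)) (f (T + 1))"
          using small_chain_repeats[of T M "\<lambda>t. D x (f (T - t)) (f (T + 1))", OF sm T] by blast
        then have "0 < T - b" "T - b < T - a" "T - a < T + 1" by linarith+
        then show False using ab bad[of 0 "T - b" "T - a" "T + 1" "T + 2" "T + 3"]
          by (simp add: bad_def t1 m'_def)
      next
        assume t2: "t = 2"
        obtain a b where ab: "a < b" "b < T"
          "D x (f (T - b)) (f (T + 1 + b)) \<inter> D x (f (T - T)) (f (T + 1 + T)) \<subseteq> D x (f (T - a)) (f (T + 1 + a))"
          using small_chain_repeats[of T M "\<lambda>t. D x (f (T - t)) (f (T + 1 + t))", OF sm T] by blast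
        then have "0 < T - b" "T - b < T - a" "T - a < T + 1 + a" by linarith+
        then show False using ab bad[of 0 "T - b" "T - a" "T + 1 + a" "T + 1 + b" "T + 1 + T"]
          by (simp add: bad_def t2 m'_def)
      qed
    qed
    have mm: "m \<le> m'" by (simp add: m'_def)
    have "outer_in_inner m (\<lambda>i j. D x (f i) (f j))" if x: "x \<in> L" for x
      unfolding outer_in_inner_def
    proof (intro allI impI)
      fix h' h i j l l' assume lt: "h' < h" "h < i" "i < j" "j < l" "l < l'" "l' < m"
      have "l' < m'" using lt mm by simp
      from col(1)[OF lt(1-5) this] have "\<not> bad x t (f h') (f h) (f i) (f j) (f l) (f l')" if "t < 3" for t
        using x that empty by auto
      from this[of 0] this[of 1] this[of 2]
      show "D x (f i) (f l) \<inter> D x (f i) (f l') \<subseteq> D x (f i) (f j) \<and>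
          D x (f h) (f j) \<inter> D x (f h') (f j) \<subseteq> D x (f i) (f j) \<and>
          D x (f h) (f l) \<inter> D x (f h') (f l') \<subseteq> D x (f i) (f j)"
        by (simp add: bad_def)
    qed
    moreover have "c (f i) (f j) = c0" if "i < j" "j + 4 < m" for i j
      using col(2)[of i j "j + 1" "j + 2" "j + 3" "j + 4"] that mm by simp
    moreover have "f i < N" if "i < m" for i
    proof -
      have "f i \<in> H" using f(2) that mm by auto
      then show ?thesis using H(1) by blast
    qed
    moreover have "f i < f j" if "i < j" "j < m" for i j using f(1) that mm by simp
    ultimately show ?thesis by blast
  qed
  then show ?thesis by blast
qed

lemma enumeration_of_small:
  assumes "small M W"
  shows "\<exists>w. W \<subseteq> w ` {..<M}"
proof -
  obtain w where "bij_betw w {0..<card W} W" using assms ex_bij_betw_nat_finite unfolding small_def by blast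
  then have "W = w ` {0..<card W}" by (simp add: bij_betw_def)
  then have "W \<subseteq> w ` {..<M}" using assms unfolding small_def
    by (metis atLeast0LessThan image_mono lessThan_subset_iff)
  then show ?thesis by blast
qed

text \<open>
  Enumerate the points that occur in the families with index \<open>i\<close>, and apply Ramsey's theorem to the
  equalities between points of different indices and to the way the families are built from them. In a
  homogeneous triple \<open>i < j < l\<close> a point of index \<open>i\<close> that equals a point of index \<open>j\<close> at another
  position is, by comparison with \<open>l\<close>, fixed when \<open>i\<close> is replaced by \<open>j\<close>. So exchanging points
  of equal position is a well-defined involution.
\<close>

lemma swapping_involution:
  fixes J :: "'j set"
  assumes J: "finite J"
  shows "\<exists>N. \<forall>X :: nat \<Rightarrow> 'j \<Rightarrow> nat fset set.
    (\<forall>i. \<forall>x\<in>J. small M (X i x) \<and> (\<forall>s\<in>X i x. fcard s \<le> M)) \<longrightarrow>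
    (\<exists>i j g. i < j \<and> j < N \<and> g \<circ> g = id \<and> (\<forall>x\<in>J. (\<lambda>s. g |`| s) ` X i x = X j x))"
proof -
  define K where "K = card J * (M * M)"
  let ?P = "Pow ({..<K} \<times> {..<K})"
  have "finite (Pow (J \<times> Pow {..<K}) \<times> Pow (J \<times> Pow {..<K}) \<times> ?P \<times> ?P \<times> ?P)" using J by simp
  from finite_colour_ramsey[OF this, of 2 3] obtain N :: nat where
    N: "\<forall>col. (\<forall>Y\<in>nsets {..<N} 2. col Y \<in> Pow (J \<times> Pow {..<K}) \<times> Pow (J \<times> Pow {..<K}) \<times> ?P \<times> ?P \<times> ?P) \<longrightarrow>
      (\<exists>H\<subseteq>{..<N}. card H = 3 \<and> (\<exists>c. \<forall>Y\<in>nsets H 2. col Y = c))" by blast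
  have "\<exists>i j g. i < j \<and> j < N \<and> g \<circ> g = id \<and> (\<forall>x\<in>J. (\<lambda>s. g |`| s) ` X i x = X j x)"
    if X: "\<forall>i. \<forall>x\<in>J. small M (X i x) \<and> (\<forall>s\<in>X i x. fcard s \<le> M)" for X :: "nat \<Rightarrow> 'j \<Rightarrow> nat fset set"
  proof -
    define W where "W i = (\<Union>x\<in>J. \<Union>s\<in>X i x. fset s)" for i
    have "small K (W i)" for i
    proof -
      have finX: "finite (X i x)" "card (X i x) \<le> M" if "x \<in> J" for x
        using X that by (auto simp: small_def)
      have "card (W i) \<le> (\<Sum>x\<in>J. card (\<Union>s\<in>X i x. fset s))"
        unfolding W_def by (rule card_UN_le[OF J])
      also have "\<dots> \<le> (\<Sum>x\<in>J. M * M)"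
      proof (rule sum_mono)
        fix x assume x: "x \<in> J"
        have "card (\<Union>s\<in>X i x. fset s) \<le> (\<Sum>s\<in>X i x. card (fset s))"
          by (rule card_UN_le[OF finX(1)[OF x]])
        also have "\<dots> \<le> (\<Sum>s\<in>X i x. M)"
          using X x by (intro sum_mono) (simp add: fcard.rep_eq[symmetric])
        also have "\<dots> \<le> M * M" using finX(2)[OF x] by simp
        finally show "card (\<Union>s\<in>X i x. fset s) \<le> M * M" .
      qed
      finally have "card (W i) \<le> K" by (simp add: K_def)
      moreover have "finite (W i)" unfolding W_def using J finX(1) by auto
      ultimately show ?thesis by (simp add: small_def)
    qed
    then have "\<forall>i. \<exists>w. W i \<subseteq> w ` {..<K}" using enumeration_of_small by blast
    from choice[OF this] obtain w where w: "\<And>i. W i \<subseteq> w i ` {..<K}" by blast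
    define tmpl where "tmpl i = {(x, S) \<in> J \<times> Pow {..<K}. \<exists>s\<in>X i x. fset s = w i ` S}" for i
    define eqs where "eqs i j = {(a, b) \<in> {..<K} \<times> {..<K}. w i a = w j b}" for i j
    define col where "col Y = (let i = Min Y; j = Max Y in (tmpl i, tmpl j, eqs i i, eqs j j, eqs i j))" for Y
    have "\<forall>Y\<in>nsets {..<N} 2. col Y \<in> Pow (J \<times> Pow {..<K}) \<times> Pow (J \<times> Pow {..<K}) \<times> ?P \<times> ?P \<times> ?P"
      by (auto simp: col_def Let_def tmpl_def eqs_def)
    from N[THEN spec, THEN mp, OF this]
    obtain H c where H: "H \<subseteq> {..<N}" "card H = 3" "\<And>Y. Y \<in> nsets H 2 \<Longrightarrow> col Y = c" by blast
    obtain i j l where ijl: "H = {i, j, l}" "i < j" "j < l"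
    proof -
      have "H \<in> nsets H 3" using H(2) card.infinite[of H] by (fastforce simp: nsets_def)
      then show ?thesis using that unfolding ordered_nsets_3_eq by blast
    qed
    have col_pair: "(tmpl a, tmpl b, eqs a a, eqs b b, eqs a b) = c" if "a \<in> H" "b \<in> H" "a < b" for a b
    proof -
      have "{a, b} \<in> nsets H 2" using that by (auto simp: nsets_def)
      from H(3)[OF this] show ?thesis using that(3) by (simp add: col_def Let_def min_def max_def)
    qed
    note cij = col_pair[of i j] and cil = col_pair[of i l] and cjl = col_pair[of j l]
    have tm: "tmpl i = tmpl j" and inn: "eqs i i = eqs j j" and
      cr1: "eqs i l = eqs i j" and cr2: "eqs j l = eqs i j"
      using cij cil cjl ijl by auto
    have inner: "w i a = w i b \<longleftrightarrow> w j a = w j b" if "a < K" "b < K" for a b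
    proof -
      have "(a, b) \<in> eqs i i \<longleftrightarrow> (a, b) \<in> eqs j j" using inn by simp
      then show ?thesis using that by (simp add: eqs_def)
    qed
    \<comment> \<open>The comparison with the third index \<open>l\<close> of the triple.\<close>
    have cross: "w j a = w i b" if "a < K" "b < K" "w i a = w j b" for a b
    proof -
      have "(a, b) \<in> eqs i j" using that by (simp add: eqs_def)
      then have "(a, b) \<in> eqs i l" "(a, b) \<in> eqs j l" using cr1 cr2 by simp_all
      then have "w i a = w l b" "w j a = w l b" by (simp_all add: eqs_def)
      then show ?thesis using that inner[of a b] by simp
    qed
    define g where "g x = (if \<exists>a<K. x = w i a then w j (SOME a. a < K \<and> x = w i a)
        else if \<exists>a<K. x = w j a then w i (SOME a. a < K \<and> x = w j a) else x)" for x
    have gi: "g (w i a) = w j a" if a: "a < K" for a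
    proof -
      let ?a = "SOME b. b < K \<and> w i a = w i b"
      have "?a < K \<and> w i a = w i ?a" by (rule someI[of _ a]) (use a in simp)
      then have "w j ?a = w j a" using inner a by metis
      then show ?thesis using a unfolding g_def by auto
    qed
    have gj: "g (w j a) = w i a" if a: "a < K" for a
    proof (cases "\<exists>b<K. w j a = w i b")
      case True
      then obtain b where b: "b < K" "w j a = w i b" by blast
      then show ?thesis using gi[OF b(1)] cross[OF b(1) a] by simp
    next
      case False
      let ?a = "SOME b. b < K \<and> w j a = w j b"
      have "?a < K \<and> w j a = w j ?a" by (rule someI[of _ a]) (use a in simp)
      then have "w i ?a = w i a" using inner a by metis
      then show ?thesis using a False unfolding g_def by auto
    qed
    have inv: "g \<circ> g = id"
    proof (rule ext)
      fix x
      show "(g \<circ> g) x = id x"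
      proof (cases "(\<exists>a<K. x = w i a) \<or> (\<exists>a<K. x = w j a)")
        case True
        then show ?thesis using gi gj by auto
      next
        case False
        then have "g x = x" unfolding g_def by auto
        then show ?thesis by simp
      qed
    qed
    have move: "g |`| s \<in> X b x"
      if x: "x \<in> J" and s: "s \<in> X a x" and t: "tmpl a = tmpl b" and g: "\<And>k. k < K \<Longrightarrow> g (w a k) = w b k"
      for a b x s
    proof -
      define S where "S = {k. k < K \<and> w a k \<in> fset s}"
      have "fset s \<subseteq> w a ` {..<K}" using w[of a] x s unfolding W_def by blast
      then have S: "fset s = w a ` S" "S \<subseteq> {..<K}" unfolding S_def by auto
      then have "(x, S) \<in> tmpl a" using x s by (auto simp: tmpl_def)
      then have "(x, S) \<in> tmpl b" using t by simp
      then obtain s' where s': "s' \<in> X b x" "fset s' = w b ` S" unfolding tmpl_def by blast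
      have "g ` (w a ` S) = w b ` S" using g S(2) by (force simp: image_image)
      then have "fset (g |`| s) = fset s'" using S s' by simp
      then have "g |`| s = s'" by (simp only: fset_inject)
      then show ?thesis using s'(1) by (simp only:)
    qed
    have "(\<lambda>s. g |`| s) ` X i x = X j x" if x: "x \<in> J" for x
    proof
      show "(\<lambda>s. g |`| s) ` X i x \<subseteq> X j x" using move[OF x _ tm gi] by blast
      show "X j x \<subseteq> (\<lambda>s. g |`| s) ` X i x"
      proof
        fix s assume "s \<in> X j x"
        then have "g |`| s \<in> X i x" using move[OF x _ tm[symmetric] gj] by blast
        then show "s \<in> (\<lambda>s. g |`| s) ` X i x"
          using fimage_involution[OF inv, of s] by (intro image_eqI[of _ _ "g |`| s"]) simp_all
      qed
    qed
    moreover have "j < N" using H(1) ijl by auto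
    ultimately show ?thesis using ijl(2) inv by blast
  qed
  then show ?thesis by blast
qed

section \<open>Exchanging two indices of a chain\<close>

text \<open>
  The first \<open>R\<close> and the last \<open>R\<close> of the \<open>m\<close> indices serve as reference points. The three parts collect
  what occurs for at least two reference points: in row \<open>i\<close> at its far end, in column \<open>j\<close> at its far
  end, and in the nested entries of the far corner.
\<close>

definition row_part :: "nat \<Rightarrow> nat \<Rightarrow> (nat \<Rightarrow> nat \<Rightarrow> 'a set) \<Rightarrow> nat \<Rightarrow> 'a set" where
  "row_part R m D i = {w. \<exists>t<R. \<exists>t'<R. t < t' \<and> w \<in> D i (m - 1 - t) \<and> w \<in> D i (m - 1 - t')}"

definition col_part :: "nat \<Rightarrow> (nat \<Rightarrow> nat \<Rightarrow> 'a set) \<Rightarrow> nat \<Rightarrow> 'a set" where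
  "col_part R D j = {w. \<exists>t<R. \<exists>t'<R. t < t' \<and> w \<in> D t j \<and> w \<in> D t' j}"

definition corner_part :: "nat \<Rightarrow> nat \<Rightarrow> (nat \<Rightarrow> nat \<Rightarrow> 'a set) \<Rightarrow> 'a set" where
  "corner_part R m D = {w. \<exists>t<R. \<exists>t'<R. t < t' \<and> w \<in> D t (m - 1 - t) \<and> w \<in> D t' (m - 1 - t')}"

lemma parts_in_entry:
  assumes D: "outer_in_inner m D" and R: "2 \<le> R" and ij: "R \<le> i" "i < j" "j + R < m"
  shows "row_part R m D i \<union> col_part R D j \<union> corner_part R m D \<subseteq> D i j"
proof -
  have *: "D i l \<inter> D i l' \<subseteq> D i j \<and> D h j \<inter> D h' j \<subseteq> D i j \<and> D h l \<inter> D h' l' \<subseteq> D i j"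
    if "h' < h" "h < i" "j < l" "l < l'" "l' < m" for h h' l l'
    using D that ij(2) unfolding outer_in_inner_def by blast
  have pts: "t < t'" "t' < i" "j < m - 1 - t'" "m - 1 - t' < m - 1 - t" "m - 1 - t < m"
    if "t < t'" "t' < R" for t t' using that ij by linarith+
  have "w \<in> D i j" if "w \<in> D i (m - 1 - t)" "w \<in> D i (m - 1 - t')" "t < t'" "t' < R" for w t t'
    using *[OF pts[OF that(3,4)]] that by blast
  moreover have "w \<in> D i j" if "w \<in> D t j" "w \<in> D t' j" "t < t'" "t' < R" for w t t'
    using *[OF pts[OF that(3,4)]] that by blast
  moreover have "w \<in> D i j" if "w \<in> D t (m - 1 - t)" "w \<in> D t' (m - 1 - t')" "t < t'" "t' < R" for w t t'
    using *[OF pts[OF that(3,4)]] that by blast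
  ultimately show ?thesis unfolding row_part_def col_part_def corner_part_def by blast
qed

lemma small_UN_lessThan:
  assumes "\<And>t. t < R \<Longrightarrow> small M (A t)"
  shows "small (R * M) (\<Union>t<R. A t)"
proof -
  have "card (\<Union>t<R. A t) \<le> (\<Sum>t<R. card (A t))" by (rule card_UN_le) simp
  also have "\<dots> \<le> (\<Sum>t<R. M)" using assms by (intro sum_mono) (simp add: small_def)
  finally show ?thesis using assms by (simp add: small_def)
qed

lemma small_subset: "small M B \<Longrightarrow> A \<subseteq> B \<Longrightarrow> small M A"
  unfolding small_def by (meson card_mono finite_subset le_trans)

lemma small_parts:
  assumes "\<And>i j. small M (D i j)"
  shows "small (R * M) (row_part R m D i)" "small (R * M) (col_part R D j)"
    "small (R * M) (corner_part R m D)"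
proof -
  show "small (R * M) (row_part R m D i)"
    by (rule small_subset[OF small_UN_lessThan[of R M "\<lambda>t. D i (m - 1 - t)"]])
       (use assms in \<open>auto simp: row_part_def\<close>)
  show "small (R * M) (col_part R D j)"
    by (rule small_subset[OF small_UN_lessThan[of R M "\<lambda>t. D t j"]])
       (use assms in \<open>auto simp: col_part_def\<close>)
  show "small (R * M) (corner_part R m D)"
    by (rule small_subset[OF small_UN_lessThan[of R M "\<lambda>t. D t (m - 1 - t)"]])
       (use assms in \<open>auto simp: corner_part_def\<close>)
qed

text \<open>
  For each \<open>t < R\<close> the entry \<open>\<alpha> j + \<beta> i\<close> is the sum of the entries at \<open>(j, m - 1 - t)\<close>, \<open>(t, m - 1 - t)\<close> and
  \<open>(t, i)\<close>, so a set \<open>u\<close> in its support includes a core element of one of them. There are fewer than \<open>R\<close>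
  possibilities for this subset of \<open>u\<close> and for the entry it comes from, so one possibility occurs for
  two different \<open>t\<close>.
\<close>

lemma covers_by_parts:
  fixes \<alpha> \<beta> :: "nat \<Rightarrow> nat fset \<Rightarrow> bit"
  assumes G: "\<And>i. \<alpha> i \<in> Ggrp n" "\<And>i. \<beta> i \<in> Ggrp n"
    and D: "D = (\<lambda>i j. core n k (\<alpha> i + \<beta> j))" and R: "3 * 2 ^ n < R"
  shows "covers (row_part R m D j \<union> col_part R D i \<union> corner_part R m D) (\<alpha> j + \<beta> i)"
  unfolding covers_def
proof (intro allI impI)
  fix u assume u: "(\<alpha> j + \<beta> i) u \<noteq> 0"
  have cov: "covers (D p q) (\<alpha> p + \<beta> q)" for p q
    unfolding D using covers_core Ggrp_add G by blast
  have "\<exists>w. (w |\<subseteq>| u) \<and> (w \<in> D j (m - 1 - t) \<or> w \<in> D t i \<or> w \<in> D t (m - 1 - t))" for t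
  proof -
    let ?l = "m - 1 - t"
    have "(\<alpha> j + \<beta> ?l) u + ((\<alpha> t + \<beta> ?l) u + (\<alpha> t + \<beta> i) u) = (\<alpha> j + \<beta> i) u"
      by (simp only: plus_fun_apply) (cases "\<beta> ?l u"; cases "\<alpha> t u"; cases "\<alpha> j u"; cases "\<beta> i u"; simp)
    then have "(\<alpha> j + \<beta> ?l) u \<noteq> 0 \<or> (\<alpha> t + \<beta> ?l) u \<noteq> 0 \<or> (\<alpha> t + \<beta> i) u \<noteq> 0"
      using u by (metis add_0)
    then show ?thesis using cov unfolding covers_def by blast
  qed
  then have "\<forall>t. \<exists>w. (w |\<subseteq>| u) \<and> (w \<in> D j (m - 1 - t) \<or> w \<in> D t i \<or> w \<in> D t (m - 1 - t))" by blast
  from choice[OF this] obtain w where w: "\<And>t. w t |\<subseteq>| u"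
    "\<And>t. w t \<in> D j (m - 1 - t) \<or> w t \<in> D t i \<or> w t \<in> D t (m - 1 - t)" by blast
  define kind :: "nat \<Rightarrow> nat" where
    "kind t = (if w t \<in> D j (m - 1 - t) then 0 else if w t \<in> D t i then 1 else 2)" for t
  have fc: "fcard u = n" using Ggrp_fcard[OF Ggrp_add[OF G] u] .
  have "(\<lambda>t. (kind t, fset (w t))) ` {..<R} \<subseteq> {..<3} \<times> Pow (fset u)"
    using w(1) by (auto simp: kind_def less_eq_fset.rep_eq)
  then have "card ((\<lambda>t. (kind t, fset (w t))) ` {..<R}) \<le> card ({..<3::nat} \<times> Pow (fset u))"
    by (intro card_mono) auto
  also have "\<dots> = 3 * 2 ^ n" using fc by (simp add: card_cartesian_product card_Pow fcard.rep_eq)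
  finally have "\<not> inj_on (\<lambda>t. (kind t, fset (w t))) {..<R}" using R by (intro pigeonhole) simp
  then obtain t0 t1 where t01: "t0 < R" "t1 < R" "t0 \<noteq> t1" "kind t0 = kind t1" "w t0 = w t1"
    unfolding inj_on_def by (auto simp: fset_inject)
  have two: "w t \<in> row_part R m D j \<union> col_part R D i \<union> corner_part R m D"
    if t: "t < t'" "t' < R" "kind t = kind t'" "w t = w t'" for t t'
  proof -
    have tR: "t < R" using t by simp
    consider "w t \<in> D j (m - 1 - t)" "w t \<in> D j (m - 1 - t')" | "w t \<in> D t i" "w t \<in> D t' i"
      | "w t \<in> D t (m - 1 - t)" "w t \<in> D t' (m - 1 - t')"
      using t(3,4) w(2)[of t] w(2)[of t'] by (auto simp: kind_def split: if_splits)
    then show ?thesis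
    proof cases
      case 1
      then have "w t \<in> row_part R m D j" unfolding row_part_def using t(1,2) tR by blast
      then show ?thesis by blast
    next
      case 2
      then have "w t \<in> col_part R D i" unfolding col_part_def using t(1,2) tR by blast
      then show ?thesis by blast
    next
      case 3
      then have "w t \<in> corner_part R m D" unfolding corner_part_def using t(1,2) tR by blast
      then show ?thesis by blast
    qed
  qed
  have "w t0 \<in> row_part R m D j \<union> col_part R D i \<union> corner_part R m D"
    using two[of t0 t1] two[of t1 t0] t01 by (metis linorder_neqE_nat)
  then show "\<exists>s\<in>row_part R m D j \<union> col_part R D i \<union> corner_part R m D. s |\<subseteq>| u" using w(1) by blast
qed

text \<open>
  A small cover of \<open>\<alpha> i + \<beta> j\<close> covers its core and hence the parts of \<open>(i, j)\<close>. The permutation carries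
  these to the parts of \<open>(j, i)\<close>, which suffice to cover \<open>\<alpha> j + \<beta> i\<close>.
\<close>

lemma swap_covers:
  fixes \<alpha> \<beta> :: "nat \<Rightarrow> nat fset \<Rightarrow> bit"
  assumes G: "\<And>i. \<alpha> i \<in> Ggrp n" "\<And>i. \<beta> i \<in> Ggrp n"
    and D: "D = (\<lambda>i j. core n k (\<alpha> i + \<beta> j))" and R: "3 * 2 ^ n < R" "2 \<le> R"
    and oi: "outer_in_inner m D" and ij: "R \<le> i" "i < j" "j + R < m"
    and g: "(\<lambda>s. g |`| s) ` row_part R m D i = row_part R m D j"
      "(\<lambda>s. g |`| s) ` col_part R D j = col_part R D i"
      "(\<lambda>s. g |`| s) ` corner_part R m D = corner_part R m D"
    and F: "small k F" "covers F (\<alpha> i + \<beta> j)"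
  shows "covers ((\<lambda>s. g |`| s) ` F) (\<alpha> j + \<beta> i)"
proof (rule covers_refine[OF covers_by_parts[OF G D R(1)]])
  fix s assume "s \<in> row_part R m D j \<union> col_part R D i \<union> corner_part R m D"
  then have "s \<in> (\<lambda>s. g |`| s) ` (row_part R m D i \<union> col_part R D j \<union> corner_part R m D)"
    unfolding image_Un g .
  then obtain r where r: "r \<in> D i j" "s = g |`| r" using parts_in_entry[OF oi R(2) ij] by blast
  then obtain t where "t \<in> F" "t |\<subseteq>| r" using core_below_cover[OF F] unfolding D by blast
  then have "g |`| t \<in> (\<lambda>s. g |`| s) ` F" "g |`| t |\<subseteq>| s" using r(2) by (simp_all add: fimage_mono)
  then show "\<exists>t\<in>(\<lambda>s. g |`| s) ` F. t |\<subseteq>| s" by blast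
qed

lemma core_fcard: "s \<in> core n k f \<Longrightarrow> fcard s \<le> n"
  by (simp add: core_def)

text \<open>
  Encodes a value in \<open>\<omega>\<close> as a family, so that \<open>swapping_involution\<close> applies to it as well; the empty
  family marks the other sort.
\<close>

definition name_family :: "melem \<Rightarrow> nat fset set" where
  "name_family x = (case x of Inl \<eta> \<Rightarrow> {} | Inr m \<Rightarrow> {{|m|}})"

lemma name_family_act: "(\<lambda>s. g |`| s) ` name_family x = name_family (act g x)"
  by (cases x) (auto simp: name_family_def)

lemma name_family_eq_iff: "name_family x = name_family y \<Longrightarrow> x = Inr m \<longleftrightarrow> y = Inr m"
  by (cases x; cases y) (auto simp: name_family_def)

lemma vsum_act: "finite A \<Longrightarrow> vsum (act g \<circ> e) A = act_vec g (vsum e A)"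
proof (induction A rule: finite_induct)
  case empty
  show ?case unfolding vsum_def by (simp only: sum.empty act_vec_0)
next
  case (insert j A)
  have ins: "vsum e (insert j A) = vec (e j) + vsum e A" for e
    unfolding vsum_def using insert.hyps by (intro sum.insert)
  have "vec (act g x) = act_vec g (vec x)" for x by (cases x) (simp_all add: act_vec_0)
  then show ?case unfolding ins insert.IH act_vec_add by (simp only: comp_apply)
qed

lemma vsum_split:
  assumes "finite A"
  shows "vsum (\<lambda>k. if k < p then a k else b k) A = vsum a (A \<inter> {..<p}) + vsum b (A - {..<p})"
proof -
  have "vsum (\<lambda>k. if k < p then a k else b k) A =
      (\<Sum>k\<in>A \<inter> {..<p}. vec (if k < p then a k else b k)) + (\<Sum>k\<in>A - {..<p}. vec (if k < p then a k else b k))"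
    unfolding vsum_def using assms by (subst sum.union_disjoint[symmetric]) (auto intro: sum.cong)
  also have "(\<Sum>k\<in>A \<inter> {..<p}. vec (if k < p then a k else b k)) = vsum a (A \<inter> {..<p})"
    unfolding vsum_def by (rule sum.cong) auto
  also have "(\<Sum>k\<in>A - {..<p}. vec (if k < p then a k else b k)) = vsum b (A - {..<p})"
    unfolding vsum_def by (rule sum.cong) auto
  finally show ?thesis .
qed

text \<open>
  Two Ramsey arguments in a row, the second one on the middle indices of the first, provide \<open>i < j\<close> and
  an involution \<open>g\<close> that exchanges all relevant families of index \<open>i\<close> and \<open>j\<close>. Then the assignment
  \<open>(a\<^sub>i, b\<^sub>j)\<close> and the image of \<open>(a\<^sub>j, b\<^sub>i)\<close> under \<open>g\<close> are matched in the sense of \<open>sim\<close>: covers are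
  transported from the first to the second by \<open>swap_covers\<close>, and back by the same lemma with the roles
  of \<open>\<alpha>\<close> and \<open>\<beta>\<close> exchanged.
\<close>

lemma no_long_chain:
  "\<exists>L. \<nexists>a b. (\<forall>i k. a i k \<in> univ Mstruct) \<and> (\<forall>j k. b j k \<in> univ Mstruct) \<and>
    (\<forall>i<L. \<forall>j<L. sat Mstruct (\<lambda>k. if k < p then a i k else b j k) \<phi> \<longleftrightarrow> i < (j::nat))"
proof -
  obtain V K0 where "bounded_by V K0 \<phi>" using ex_bounded_by by blast
  then have bd: "bounded_by V (Suc K0) \<phi>" by (rule bounded_by_mono) simp_all
  define K where "K = Suc K0"
  obtain k where k: "k \<ge> 1" and sat: "\<And>e e'. (\<forall>i. e i \<in> univ Mstruct) \<Longrightarrow> (\<forall>i. e' i \<in> univ Mstruct) \<Longrightarrow>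
      sim V K k e e' \<Longrightarrow> sat Mstruct e \<phi> \<longleftrightarrow> sat Mstruct e' \<phi>"
    using sat_sim[OF bd] unfolding K_def by auto
  define I where "I = Pow {..<V} \<times> {..<K} \<times> (UNIV :: bool set)"
  define M where "M = k ^ K"
  define R where "R = (3 * 2 ^ K + 5 :: nat)"
  define J where "J = Inl ` (I \<times> {..<3::nat}) \<union> Inr ` ({..<V} \<times> (UNIV :: bool set))"
  define MM where "MM = R * M + K + 1"
  have I: "finite I" by (simp add: I_def)
  have J: "finite J" by (simp add: J_def I)
  obtain NJ where NJ: "\<forall>X :: nat \<Rightarrow> _ \<Rightarrow> nat fset set.
    (\<forall>i. \<forall>x\<in>J. small MM (X i x) \<and> (\<forall>s\<in>X i x. fcard s \<le> MM)) \<longrightarrow>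
    (\<exists>i j g. i < j \<and> j < NJ \<and> g \<circ> g = id \<and> (\<forall>x\<in>J. (\<lambda>s. g |`| s) ` X i x = X j x))"
    using swapping_involution[OF J, of MM] by (rule exE)
  note NJ = NJ[THEN spec, THEN mp]
  define m where "m = 2 * R + NJ + 1"
  have C: "finite (Pow (Pow {..<V} \<times> (UNIV :: bool set)))" by simp
  obtain L where L: "\<forall>(D :: _ \<Rightarrow> nat \<Rightarrow> nat \<Rightarrow> nat fset set) c.
    (\<forall>x\<in>I. \<forall>i j. small M (D x i j)) \<longrightarrow> (\<forall>i j. c i j \<in> Pow (Pow {..<V} \<times> (UNIV :: bool set))) \<longrightarrow>
    (\<exists>f. (\<forall>i j. i < j \<longrightarrow> j < m \<longrightarrow> f i < f j) \<and> (\<forall>i<m. f i < L) \<and>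
      (\<forall>x\<in>I. outer_in_inner m (\<lambda>i j. D x (f i) (f j))) \<and>
      (\<exists>c0. \<forall>i j. i < j \<longrightarrow> j + 4 < m \<longrightarrow> c (f i) (f j) = c0))"
    using ramsey_outer_in_inner[OF I C, of M m] by (rule exE)
  note L = L[THEN spec, THEN spec, THEN mp, THEN mp]
  have no_chain: False
    if a: "\<forall>i k. a i k \<in> univ Mstruct" and b: "\<forall>j k. b j k \<in> univ Mstruct"
      and chain: "\<forall>i<L. \<forall>j<L. sat Mstruct (\<lambda>k. if k < p then a i k else b j k) \<phi> \<longleftrightarrow> i < j"
    for a b :: "nat \<Rightarrow> nat \<Rightarrow> melem"
  proof -
    define \<alpha> where "\<alpha> A i = vsum (a i) (A \<inter> {..<p})" for A i
    define \<beta> where "\<beta> A j = vsum (b j) (A - {..<p})" for A j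
    have ab: "\<alpha> A i \<in> Gomega" "\<beta> A i \<in> Gomega" for A i
      unfolding \<alpha>_def \<beta>_def by (rule vsum_in_Gomega, simp add: a b)+
    have G: "\<alpha> A i n \<in> Ggrp n" "\<beta> A i n \<in> Ggrp n" for A i n
      using ab unfolding Gomega_def by blast+
    \<comment> \<open>The flag \<open>d\<close> tells whether \<open>\<alpha>\<close> or \<open>\<beta>\<close> carries the row index. Both versions are read above the
      diagonal, so together they describe the entries on both sides of it.\<close>
    define E where "E x i j = (case x of (A, n, d) \<Rightarrow>
        core n k (if d then \<alpha> A i n + \<beta> A j n else \<beta> A i n + \<alpha> A j n))" for x :: "nat set \<times> nat \<times> bool" and i j
    define c where "c i j = {(A, d). A \<subseteq> {..<V} \<and> (if d then \<alpha> A i + \<beta> A j = 0 else \<beta> A i + \<alpha> A j = 0)}" for i j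
    have smallE: "small M (E x i j)" if xI: "x \<in> I" for x i j
    proof -
      obtain A n d where x: "x = (A, n, d)" "n < K" using xI by (auto simp: I_def)
      have "small (k ^ n) (E x i j)" unfolding x E_def using small_core[OF k] by simp
      moreover have "k ^ n \<le> M" unfolding M_def using k x(2) by (intro power_increasing) auto
      ultimately show ?thesis by (rule small_mono)
    qed
    have E1: "\<forall>x\<in>I. \<forall>i j. small M (E x i j)" using smallE by blast
    have c1: "\<forall>i j. c i j \<in> Pow (Pow {..<V} \<times> UNIV)" by (auto simp: c_def)
    define good where "good f \<longleftrightarrow> (\<forall>i j. i < j \<longrightarrow> j < m \<longrightarrow> f i < f j) \<and> (\<forall>i<m. f i < L) \<and>
      (\<forall>x\<in>I. outer_in_inner m (\<lambda>i j. E x (f i) (f j))) \<and>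
      (\<exists>c0. \<forall>i j. i < j \<longrightarrow> j + 4 < m \<longrightarrow> c (f i) (f j) = c0)" for f
    have "\<exists>f. good f" unfolding good_def by (rule L[OF E1 c1])
    then obtain f where "good f" by (rule exE)
    then have f: "\<And>i j. i < j \<Longrightarrow> j < m \<Longrightarrow> f i < f j" "\<And>i. i < m \<Longrightarrow> f i < L"
      and oi: "\<And>x. x \<in> I \<Longrightarrow> outer_in_inner m (\<lambda>i j. E x (f i) (f j))"
      and "\<exists>c0. \<forall>i j. i < j \<longrightarrow> j + 4 < m \<longrightarrow> c (f i) (f j) = c0"
      by (simp_all only: good_def)
    then obtain c0 where c0: "\<And>i j. i < j \<Longrightarrow> j + 4 < m \<Longrightarrow> c (f i) (f j) = c0" by blast
    define D where "D x i j = E x (f i) (f j)" for x i j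
    define X where "X i y = (case y of
        Inl (x, t) \<Rightarrow> (if t = 0 then row_part R m (D x) (R + i)
          else if t = 1 then col_part R (D x) (R + i) else corner_part R m (D x))
      | Inr (v, d) \<Rightarrow> name_family (if d then a (f (R + i)) v else b (f (R + i)) v))"
      for i and y :: "(nat set \<times> nat \<times> bool) \<times> nat + nat \<times> bool"
    have "small MM (X i y) \<and> (\<forall>s\<in>X i y. fcard s \<le> MM)" if y: "y \<in> J" for i y
    proof (cases y)
      case (Inl z)
      then obtain x t where z: "z = (x, t)" "x \<in> I" "t < 3" using y by (auto simp: J_def)
      have "small (R * M) (X i y)"
        using small_parts[of M "D x" R] smallE[OF z(2)] by (simp add: X_def Inl z(1) D_def)
      then have "small MM (X i y)" by (rule small_mono) (simp add: MM_def)
      moreover have "fcard s \<le> K" if "s \<in> D x p q" for s p q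
      proof -
        obtain A n d where x: "x = (A, n, d)" "n < K" using z(2) by (auto simp: I_def)
        then show ?thesis using that core_fcard[of s n k] by (fastforce simp: D_def E_def)
      qed
      then have "fcard s \<le> K" if "s \<in> X i y" for s
        using that by (auto simp: X_def Inl z(1) row_part_def col_part_def corner_part_def split: if_splits)
      ultimately show ?thesis by (simp add: MM_def le_SucI trans_le_add2)
    next
      case (Inr z)
      then show ?thesis
        by (cases z; simp add: X_def name_family_def MM_def small_def fcard_finsert_if fcard_fempty split: sum.split)
    qed
    then have "\<forall>i. \<forall>y\<in>J. small MM (X i y) \<and> (\<forall>s\<in>X i y. fcard s \<le> MM)" by blast
    from NJ[OF this] obtain i0 j0 g where ij0: "i0 < j0" "j0 < NJ" and g: "g \<circ> g = id"
      and gX: "\<forall>y\<in>J. (\<lambda>s. g |`| s) ` X i0 y = X j0 y"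
      by (elim exE conjE) (rule that)
    note gX = gX[THEN bspec]
    define i where "i = R + i0"
    define j where "j = R + j0"
    have ij: "R \<le> i" "i < j" "j + R < m" using ij0 by (simp_all add: i_def j_def m_def)
    have gg: "(\<lambda>s. g |`| s) ` (\<lambda>s. g |`| s) ` F = F" for F
      by (simp only: image_image fimage_involution[OF g] image_ident)
    have gX': "(\<lambda>s. g |`| s) ` X j0 y = X i0 y" if "y \<in> J" for y
      using gg[of "X i0 y"] gX[OF that] by simp
    have Rn: "3 * 2 ^ n < R" if "n < K" for n :: nat
    proof -
      have "(2::nat) ^ n \<le> 2 ^ K" using that by (intro power_increasing) auto
      then show ?thesis unfolding R_def by linarith
    qed
    have R2: "2 \<le> R" "5 \<le> R" by (simp_all add: R_def)
    have parts: "(\<lambda>s. g |`| s) ` row_part R m (D x) i = row_part R m (D x) j"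
      "(\<lambda>s. g |`| s) ` col_part R (D x) j = col_part R (D x) i"
      "(\<lambda>s. g |`| s) ` corner_part R m (D x) = corner_part R m (D x)" if "x \<in> I" for x
    proof -
      have "Inl (x, 0) \<in> J" "Inl (x, 1) \<in> J" "Inl (x, 2) \<in> J" using that by (auto simp: J_def)
      from gX[OF this(1)] gX'[OF this(2)] gX[OF this(3)]
      show "(\<lambda>s. g |`| s) ` row_part R m (D x) i = row_part R m (D x) j"
        "(\<lambda>s. g |`| s) ` col_part R (D x) j = col_part R (D x) i"
        "(\<lambda>s. g |`| s) ` corner_part R m (D x) = corner_part R m (D x)"
        by (simp_all add: X_def i_def j_def)
    qed
    have forward: "covers ((\<lambda>s. g |`| s) ` F) (\<alpha> A (f j) n + \<beta> A (f i) n)"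
      if "A \<subseteq> {..<V}" "n < K" "small k F" "covers F (\<alpha> A (f i) n + \<beta> A (f j) n)" for A n F
    proof -
      have x: "(A, n, True) \<in> I" using that by (simp add: I_def)
      have D: "D (A, n, True) = (\<lambda>i j. core n k (\<alpha> A (f i) n + \<beta> A (f j) n))"
        by (rule ext)+ (simp only: D_def E_def prod.case if_True)
      have "outer_in_inner m (D (A, n, True))" using oi[OF x] unfolding D_def .
      from swap_covers[OF G(1) G(2) D Rn[OF that(2)] R2(1) this ij parts[OF x] that(3,4)]
      show ?thesis .
    qed
    have backward: "covers ((\<lambda>s. g |`| s) ` F) (\<beta> A (f j) n + \<alpha> A (f i) n)"
      if "A \<subseteq> {..<V}" "n < K" "small k F" "covers F (\<beta> A (f i) n + \<alpha> A (f j) n)" for A n F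
    proof -
      have x: "(A, n, False) \<in> I" using that by (simp add: I_def)
      have D: "D (A, n, False) = (\<lambda>i j. core n k (\<beta> A (f i) n + \<alpha> A (f j) n))"
        by (rule ext)+ (simp only: D_def E_def prod.case if_False)
      have "outer_in_inner m (D (A, n, False))" using oi[OF x] unfolding D_def .
      from swap_covers[OF G(2) G(1) D Rn[OF that(2)] R2(1) this ij parts[OF x] that(3,4)]
      show ?thesis .
    qed
    \<comment> \<open>If the sum vanishes for one pair above the diagonal, it vanishes for all of them, and the sum
      below the diagonal is a sum of three such.\<close>
    have zero: "\<alpha> A (f i) + \<beta> A (f j) = 0 \<longleftrightarrow> \<alpha> A (f j) + \<beta> A (f i) = 0" if A: "A \<subseteq> {..<V}" for A
    proof -
      let ?l = "m - R"
      have l: "j < ?l" "?l + 4 < m" "0 < i" "i + 4 < m" "j + 4 < m" using ij R2 by linarith+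
      have cc: "c (f i) (f j) = c0" "c (f 0) (f i) = c0" "c (f j) (f ?l) = c0" "c (f 0) (f ?l) = c0"
        using c0 l ij by simp_all
      have one: "(A, d) \<in> c (f p) (f q) \<longleftrightarrow> (if d then \<alpha> A (f p) + \<beta> A (f q) = 0 else \<beta> A (f p) + \<alpha> A (f q) = 0)"
        for p q d using A by (simp add: c_def)
      show ?thesis
      proof
        assume "\<alpha> A (f i) + \<beta> A (f j) = 0"
        then have "(A, True) \<in> c0" using one[of True i j] cc(1) by simp
        then have "\<alpha> A (f 0) + \<beta> A (f i) = 0" "\<alpha> A (f j) + \<beta> A (f ?l) = 0" "\<alpha> A (f 0) + \<beta> A (f ?l) = 0"
          using one[of True 0 i] one[of True j ?l] one[of True 0 ?l] cc by simp_all
        then show "\<alpha> A (f j) + \<beta> A (f i) = 0" unfolding gomega_add_eq_0_iff by metis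
      next
        assume "\<alpha> A (f j) + \<beta> A (f i) = 0"
        then have "\<beta> A (f i) + \<alpha> A (f j) = 0" by (simp only: add.commute)
        then have "(A, False) \<in> c0" using one[of False i j] cc(1) by simp
        then have "\<beta> A (f 0) + \<alpha> A (f i) = 0" "\<beta> A (f j) + \<alpha> A (f ?l) = 0" "\<beta> A (f 0) + \<alpha> A (f ?l) = 0"
          using one[of False 0 i] one[of False j ?l] one[of False 0 ?l] cc by simp_all
        then show "\<alpha> A (f i) + \<beta> A (f j) = 0" unfolding gomega_add_eq_0_iff by metis
      qed
    qed
    define e where "e i j = (\<lambda>v. if v < p then a (f i) v else b (f j) v)" for i j
    have e_univ: "e i j v \<in> univ Mstruct" for i j v using a b by (simp add: e_def)
    have vs: "vsum (e i j) A = \<alpha> A (f i) + \<beta> A (f j)" if "A \<subseteq> {..<V}" for A i j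
    proof -
      have "finite A" using that finite_subset by blast
      then show ?thesis unfolding e_def \<alpha>_def \<beta>_def by (rule vsum_split)
    qed
    have "sim V K k (e i j) (act g \<circ> e j i)"
      unfolding sim_def
    proof (intro conjI allI impI)
      fix v m assume v: "v < V"
      have J: "Inr (v, True) \<in> J" "Inr (v, False) \<in> J" using v by (simp_all add: J_def)
      have "name_family (act g (a (f j) v)) = name_family (a (f i) v)"
        using gX'[OF J(1)] by (simp add: X_def name_family_act i_def j_def)
      moreover have "name_family (act g (b (f i) v)) = name_family (b (f j) v)"
        using gX[OF J(2)] by (simp add: X_def name_family_act i_def j_def)
      ultimately show "e i j v = Inr m \<longleftrightarrow> (act g \<circ> e j i) v = Inr m"
        using name_family_eq_iff[of "act g (a (f j) v)" "a (f i) v" m]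
          name_family_eq_iff[of "act g (b (f i) v)" "b (f j) v" m] by (simp add: e_def)
    next
      fix A assume A: "A \<subseteq> {..<V}"
      have fin: "finite A" using A finite_subset by blast
      have z: "act_vec g \<eta> = 0 \<longleftrightarrow> \<eta> = 0" for \<eta>
        using act_involution[OF g, of "Inl \<eta>"] by (metis act.simps(1) act_vec_0 sum.inject(1))
      show "vsum (e i j) A = 0 \<longleftrightarrow> vsum (act g \<circ> e j i) A = 0"
        unfolding vsum_act[OF fin] z unfolding vs[OF A] by (rule zero[OF A])
      fix n and F :: "nat fset set" assume n: "n < K" and F: "small k F"
      have smg: "small k ((\<lambda>s. g |`| s) ` F)"
        using F card_image_le[of F] unfolding small_def by (meson finite_imageI le_trans)
      have "covers F (vsum (act g \<circ> e j i) A n) \<longleftrightarrow>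
          covers ((\<lambda>s. g |`| s) ` F) (vsum (e j i) A n)"
        using covers_act[OF g, of "(\<lambda>s. g |`| s) ` F" "vsum (e j i) A" n]
        by (simp only: gg vsum_act[OF fin])
      also have "\<dots> \<longleftrightarrow> covers F (vsum (e i j) A n)"
      proof -
        have vn: "vsum (e p q) A n = \<alpha> A (f p) n + \<beta> A (f q) n" for p q
          unfolding vs[OF A] by (rule plus_fun_apply)
        show ?thesis unfolding vn
        proof
          assume "covers F (\<alpha> A (f i) n + \<beta> A (f j) n)"
          then show "covers ((\<lambda>s. g |`| s) ` F) (\<alpha> A (f j) n + \<beta> A (f i) n)"
            using forward A n F by blast
        next
          assume "covers ((\<lambda>s. g |`| s) ` F) (\<alpha> A (f j) n + \<beta> A (f i) n)"
          then have "covers ((\<lambda>s. g |`| s) ` F) (\<beta> A (f i) n + \<alpha> A (f j) n)"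
            by (simp only: add.commute[of "\<alpha> A (f j) n"])
          from backward[OF A n smg this]
          show "covers F (\<alpha> A (f i) n + \<beta> A (f j) n)"
            by (simp only: gg add.commute[of "\<beta> A (f j) n"])
        qed
      qed
      finally show "covers F (vsum (e i j) A n) \<longleftrightarrow> covers F (vsum (act g \<circ> e j i) A n)" by blast
    qed
    moreover have "\<forall>v. (act g \<circ> e j i) v \<in> univ Mstruct"
      using act_univ[OF g] e_univ by simp
    ultimately have "sat Mstruct (e i j) \<phi> \<longleftrightarrow> sat Mstruct (act g \<circ> e j i) \<phi>"
      using sat e_univ by blast
    then have "sat Mstruct (e i j) \<phi> \<longleftrightarrow> sat Mstruct (e j i) \<phi>" by (simp only: sat_act[OF g])
    moreover have "f i < f j" "f i < L" "f j < L" using f ij by simp_all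
    ultimately show False using chain unfolding e_def by auto
  qed
  show ?thesis
  proof (intro exI[of _ L] notI, elim exE conjE)
    fix a b :: "nat \<Rightarrow> nat \<Rightarrow> melem"
    assume "\<forall>i k. a i k \<in> univ Mstruct" "\<forall>j k. b j k \<in> univ Mstruct"
      "\<forall>i<L. \<forall>j<L. sat Mstruct (\<lambda>k. if k < p then a i k else b j k) \<phi> \<longleftrightarrow> i < j"
    then show False by (rule no_chain)
  qed
qed

theorem proposition4p6: "stable TYPE('a) (Th Mstruct)"
proof -
  have "\<not> order_property N p q \<phi>" if "is_model N (Th Mstruct)" for N :: "'a lstruct" and \<phi> p q
    using finite_chains_in_M[OF that] no_long_chain[of p \<phi>] by blast
  then show ?thesis by (simp add: stable_def)
qed

end
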